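(* Let $q$ be a prime power and $n$ a positive integer coprime to $q$. Then the map $\widehat{\varphi}:\mathcal{N}\to\mathcal{F}$ defined in the context is well defined and is a bijection.
   Context: Let $\mathcal{Q}=\mathbb{F}_q[X]/(X^n-1)$, and let $\mathcal{N}$ be the set of necklaces of length $n$ with $q$ colors, identified with the orbits $\{\alpha,X\alpha,\ldots,X^{n-1}\alpha\}$, $\alpha\in\mathcal{Q}$. Let $\mathcal{E}$ be the set of all functions $\mathbb{Z}_n\to\{0,\ldots,q-1\}$ and $\mathcal{F}=\{f\in\mathcal{E}:\sum_{z\in\mathbb{Z}_n}zf(z)\equiv0\pmod n\}$. Consider the equivalence relation on $\mathbb{Z}_n$ generated by $z\sim qz$; let integers $s_1,\ldots,s_m$ represent its $m$ classes, the class of $s_i$ being $S_i=\{s_i,qs_i,\ldots,q^{\ell_i-1}s_i\}$ with $\ell_i$ the smallest positive integer such that $q^{\ell_i}s_i\equiv s_i\pmod n$. Fix a primitive $n$-th root of unity $\omega$ in an algebraic closure of $\mathbb{F}_q$ and let $P_i=\prod_{k\in S_i}(X-\omega^k)\in\mathbb{F}_q[X]$, viewed in $\mathcal{Q}$. Let $G_i$ be the multiplicative group of the field $\mathcal{Q}/P_i\mathcal{Q}$ (cyclic of order $q^{\ell_i}-1$), $\alpha_i$ the image of $\alpha$ in $\mathcal{Q}/P_i\mathcal{Q}$, $X_i$ the image of $X$. Let $D_i=\frac{(q^{\ell_i}-1)\gcd(n,s_i)}{n}$ and fix a generator $g_i$ of $G_i$ with $X_i=g_i^{D_i}$. For $\alpha$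 not divisible by $P_i$, $\log_{g_i}(\alpha)$ is the least $k\ge0$ with $\alpha_i=g_i^k$, and $a_i(\alpha),b_i(\alpha)$ are the quotient and remainder of $\log_{g_i}(\alpha)$ divided by $D_i$. For each $I\subseteq\{1,\ldots,m\}$ fix a group automorphism $\phi_I$ of $\prod_{i\in I}\mathbb{Z}_{n/\gcd(n,s_i)}$ such that $\sum_{i\in I}s_ih_{i,I}\equiv\gcd(n,\gcd(s_i)_{i\in I})\pmod n$, where $h_{i,I}$ is the $i$-th coordinate of $\phi_I(1,\ldots,1)$ (such $\phi_I$ exists; $\gcd(n,\gcd(s_i)_{i\in\emptyset})=n$). Let $\mathcal{Q}_I=\{\alpha\in\mathcal{Q}: P_i\mid\alpha \text{ iff } i\notin I\}$. For $\alpha\in\mathcal{Q}_I$ and $i\in I$ let $\phi_{i,I}(\alpha)\in\{0,\ldots,\frac{n}{\gcd(n,s_i)}-1\}$ be the $i$-th coordinate of $\phi_I\big((a_i(\alpha)\bmod \tfrac{n}{\gcd(n,s_i)})_{i\in I}\big)$, and let $c_{i,0},\ldots,c_{i,\ell_i-1}\in\{0,\ldots,q-1\}$ be the base-$q$ digits with $\sum_{j=0}^{\ell_i-1}c_{i,j}q^j=b_i(\alpha)\frac{n}{\gcd(n,s_i)}+\phi_{i,I}(\alpha)$. Define $\varphi_I(\alpha)=f_\alpha\in\mathcal{E}$ by $f_\alpha(q^js_i)=q-1$ if $i\notin I$ and $f_\alpha(q^js_i)=c_{i,j}$ if $i\in I$ ($0\le j<\ell_i$). The map $\widehat{\varphi}$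 sends a necklace $\{\alpha,X\alpha,\ldots,X^{n-1}\alpha\}$ to $\varphi_I(\beta)$, where $I$ is the subset with $\alpha\in\mathcal{Q}_I$ (the same for all elements of the orbit) and $\beta$ is the unique element of $\{\alpha,X\alpha,\ldots,X^{n-1}\alpha\}$ with $\varphi_I(\beta)\in\mathcal{F}$. *)

theory Defs
  imports
    "HOL-Algebra.Algebraic_Closure_Type"
    "HOL-Algebra.Elementary_Groups"
    "HOL-Algebra.Product_Groups"
    "HOL-Number_Theory.Cong"
    "HOL-Number_Theory.Prime_Powers"
begin

text \<open>
  The ground field is a type of class \<open>finite_field\<close> with \<open>q\<close> elements. The type
  \<open>'a alg_closure\<close> is the library's algebraic closure, with embedding \<open>to_ac\<close>.
  The residue \<open>z\<close> modulo \<open>n\<close> is the integer \<open>z mod n\<close> in \<open>{0..<n}\<close>, as in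
  \<open>integer_mod_group n\<close>. The first locale only collects the data on which the
  definitions depend; the conditions on these data are in the second locale.
\<close>

locale necklace_data =
  fixes q n m :: nat
    and s :: "nat \<Rightarrow> int"
    and \<omega> :: "'a :: finite_field alg_closure"
    and g :: "nat \<Rightarrow> 'a poly set set"
    and \<phi> :: "nat set \<Rightarrow> (nat \<Rightarrow> int) \<Rightarrow> (nat \<Rightarrow> int)"
begin

definition Zn :: "int set" where
  "Zn = carrier (integer_mod_group n)"

definition \<E> :: "(int \<Rightarrow> nat) set" where
  "\<E> = Zn \<rightarrow>\<^sub>E {0..<q}"

definition \<F> :: "(int \<Rightarrow> nat) set" where
  "\<F> = {f \<in> \<E>. [(\<Sum>z\<in>Zn. z * int (f z)) = 0] (mod int n)}"

definition qrel :: "(int \<times> int) set" where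
  "qrel = {(z, w) \<in> Zn \<times> Zn. equivclp (\<lambda>x y. x \<in> Zn \<and> y = (int q * x) mod int n) z w}"

definition elt :: "nat \<Rightarrow> nat \<Rightarrow> int" where
  "elt i j = (int q ^ j * s i) mod int n"

definition \<l> :: "nat \<Rightarrow> nat" where
  "\<l> i = (LEAST l. 0 < l \<and> [int q ^ l * s i = s i] (mod int n))"

definition S :: "nat \<Rightarrow> int set" where
  "S i = elt i ` {0..<\<l> i}"

definition d :: "nat \<Rightarrow> nat" where
  "d i = nat (gcd (int n) (s i))"

definition D :: "nat \<Rightarrow> nat" where
  "D i = ((q ^ \<l> i - 1) * d i) div n"

definition A :: "nat set \<Rightarrow> (nat \<Rightarrow> int) monoid" where
  "A I = product_group I (\<lambda>i. integer_mod_group (n div d i))"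

text \<open>The entry \<open>1 mod (n div d i)\<close> is the residue class of \<open>1\<close>, also for the trivial group.\<close>

definition h :: "nat set \<Rightarrow> nat \<Rightarrow> int" where
  "h I i = \<phi> I (\<lambda>k\<in>I. 1 mod int (n div d k)) i"

definition PR :: "'a poly ring" where
  "PR = ring_of_type_algebra"

definition \<Q> :: "'a poly set ring" where
  "\<Q> = PR Quot (PIdl\<^bsub>PR\<^esub> (monom 1 n - 1))"

definition to_Q :: "'a poly \<Rightarrow> 'a poly set" where
  "to_Q p = (PIdl\<^bsub>PR\<^esub> (monom 1 n - 1)) +>\<^bsub>PR\<^esub> p"

definition XQ :: "'a poly set" where
  "XQ = to_Q (monom 1 1)"

definition orbit :: "'a poly set \<Rightarrow> 'a poly set set" where
  "orbit \<alpha> = {XQ [^]\<^bsub>\<Q>\<^esub> k \<otimes>\<^bsub>\<Q>\<^esub> \<alpha> | k. k \<in> {0..<n}}"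

definition \<N> :: "'a poly set set set" where
  "\<N> = orbit ` carrier \<Q>"

text \<open>The product over \<open>S i\<close> is formed over the algebraic closure; \<open>P i\<close> is the
  polynomial over the ground field from which it comes.\<close>

definition P :: "nat \<Rightarrow> 'a poly" where
  "P i = (THE p. map_poly to_ac p = (\<Prod>k\<in>S i. [:- (\<omega> powi k), 1:]))"

definition PQ :: "nat \<Rightarrow> 'a poly set" where
  "PQ i = to_Q (P i)"

definition K :: "nat \<Rightarrow> 'a poly set set ring" where
  "K i = \<Q> Quot (PIdl\<^bsub>\<Q>\<^esub> (PQ i))"

definition to_K :: "nat \<Rightarrow> 'a poly set \<Rightarrow> 'a poly set set" where
  "to_K i \<alpha> = (PIdl\<^bsub>\<Q>\<^esub> (PQ i)) +>\<^bsub>\<Q>\<^esub> \<alpha>"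

definition G :: "nat \<Rightarrow> 'a poly set set monoid" where
  "G i = units_of (K i)"

definition \<Q>\<^sub>I :: "nat set \<Rightarrow> 'a poly set set" where
  "\<Q>\<^sub>I I = {\<alpha> \<in> carrier \<Q>. \<forall>i\<in>{1..m}. PQ i divides\<^bsub>\<Q>\<^esub> \<alpha> \<longleftrightarrow> i \<notin> I}"

definition dlog :: "nat \<Rightarrow> 'a poly set \<Rightarrow> nat" where
  "dlog i \<alpha> = (LEAST k. to_K i \<alpha> = g i [^]\<^bsub>G i\<^esub> k)"

definition a :: "nat \<Rightarrow> 'a poly set \<Rightarrow> nat" where
  "a i \<alpha> = dlog i \<alpha> div D i"

definition b :: "nat \<Rightarrow> 'a poly set \<Rightarrow> nat" where
  "b i \<alpha> = dlog i \<alpha> mod D i"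

definition phi_coord :: "nat set \<Rightarrow> nat \<Rightarrow> 'a poly set \<Rightarrow> int" where
  "phi_coord I i \<alpha> = \<phi> I (\<lambda>k\<in>I. int (a k \<alpha>) mod int (n div d k)) i"

text \<open>Since \<open>f\<close> takes its values in \<open>{0..<q}\<close>, the equation in the first branch says that
  the \<open>f (elt i j)\<close> with \<open>j < \<l> i\<close> are the \<open>\<l> i\<close> base-\<open>q\<close> digits of the number on its
  right-hand side, the least significant one first.\<close>

definition encodes :: "nat set \<Rightarrow> 'a poly set \<Rightarrow> (int \<Rightarrow> nat) \<Rightarrow> bool" where
  "encodes I \<alpha> f \<longleftrightarrow> f \<in> \<E> \<and>
     (\<forall>i\<in>{1..m}.
        if i \<in> I then
          (\<Sum>j = 0..<\<l> i. int (f (elt i j)) * int q ^ j)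
            = int (b i \<alpha>) * int (n div d i) + phi_coord I i \<alpha>
        else \<forall>j\<in>{0..<\<l> i}. f (elt i j) = q - 1)"

definition varphi :: "nat set \<Rightarrow> 'a poly set \<Rightarrow> int \<Rightarrow> nat" where
  "varphi I \<alpha> = (THE f. encodes I \<alpha> f)"

definition index_set :: "'a poly set set \<Rightarrow> nat set" where
  "index_set N = (THE I. I \<subseteq> {1..m} \<and> N \<subseteq> \<Q>\<^sub>I I)"

definition phihat :: "'a poly set set \<Rightarrow> int \<Rightarrow> nat" where
  "phihat N = varphi (index_set N) (THE \<beta>. \<beta> \<in> N \<and> varphi (index_set N) \<beta> \<in> \<F>)"

end

locale necklace_choices = necklace_data q n m s \<omega> g \<phi>
  for q n m :: nat
    and s :: "nat \<Rightarrow> int"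
    and \<omega> :: "'a :: finite_field alg_closure"
    and g :: "nat \<Rightarrow> 'a poly set set"
    and \<phi> :: "nat set \<Rightarrow> (nat \<Rightarrow> int) \<Rightarrow> (nat \<Rightarrow> int)" +
  assumes representatives: "bij_betw (\<lambda>i. qrel `` {s i mod int n}) {1..m} (Zn // qrel)"
    and primitive_root: "\<omega> ^ n = 1" "\<And>k. 0 < k \<Longrightarrow> k < n \<Longrightarrow> \<omega> ^ k \<noteq> 1"
    and generator: "\<And>i. i \<in> {1..m} \<Longrightarrow> g i \<in> carrier (G i)"
      "\<And>i. i \<in> {1..m} \<Longrightarrow> generate (G i) {g i} = carrier (G i)"
      "\<And>i. i \<in> {1..m} \<Longrightarrow> to_K i XQ = g i [^]\<^bsub>G i\<^esub> D i"
    and automorphism: "\<And>I. I \<subseteq> {1..m} \<Longrightarrow> \<phi> I \<in> iso (A I) (A I)"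
      "\<And>I. I \<subseteq> {1..m} \<Longrightarrow>
         [(\<Sum>i\<in>I. s i * h I i) = gcd (int n) (Gcd (s ` I))] (mod int n)"

end

(* Modulo P i, evaluation at omega^(s i) turns congruences of polynomials into equations in the
   algebraic closure. Hence each factor ring is a field with q^(l i) elements, and by Chinese
   remaindering an element of Q_I is the same as a family of discrete logarithms, one for each i
   in I. Writing the logarithm as a_i * D i + b_i, the pair (phi-image of a, b) is a number below
   q^(l i) - 1, so its digits determine it, and the all-(q - 1) word is left to the i outside I;
   thus the maps varphi I together biject Q onto the set E. Multiplication by X adds 1 to every a_i,
   hence changes the sum of z * f(z) by sum_i s_i h_i, which is e = gcd(n, gcd (s_i)_{i in I})
   modulo n; since e divides this sum and n / e is the size of the orbit, exactly one element of
   each orbit lands in F. *)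

theory Submission
  imports Defs "HOL-Number_Theory.Residues"
begin

section \<open>Polynomials over finite fields\<close>

text \<open>The construction rests on \<open>D i * r i = q ^ \<l> i - 1\<close>, where
  \<open>r i = n div d i\<close> is the order of X modulo \<open>P i\<close>. The logarithm is
  \<open>a i * D i + b i\<close> with \<open>a i < r i\<close>, whereas the code is
  \<open>b i * r i\<close> plus a residue modulo \<open>r i\<close>. The two factors exchange their
  roles because the weight, the sum of z * f(z), must be readable from the \<open>a i\<close> alone:
  position j of class i has weight \<open>q ^ j * s i\<close>, so the digits of a number v
  contribute \<open>s i * v\<close> modulo n, and n divides both \<open>s i * r i\<close> and
  \<open>s i * (q ^ \<l> i - 1)\<close>. Hence the \<open>b i\<close> and the i outside I drop out.
  With the identity in place of \<open>\<phi> I\<close>, multiplication by X would change the weight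
  by the sum of the \<open>s i\<close>, whose gcd with n may exceed e; an orbit could then miss
  \<open>\<F>\<close> or meet it several times. The automorphism moves the all-ones vector to one
  for which the step is e itself.\<close>

text \<open>Homomorphy is assumed of a bare function so that both \<open>to_ac\<close> and the
  Frobenius map x ^ q qualify.\<close>

lemma map_poly_mult_hom:
  fixes f :: "'b :: comm_ring_1 \<Rightarrow> 'c :: comm_ring_1"
  assumes "f 0 = 0" "\<And>x y. f (x + y) = f x + f y" "\<And>x y. f (x * y) = f x * f y"
  shows "map_poly f (p * r) = map_poly f p * map_poly f r"
proof (rule poly_eqI)
  fix k
  have "f (\<Sum>i\<in>B. c i) = (\<Sum>i\<in>B. f (c i))" for c :: "nat \<Rightarrow> 'b" and B
    by (induction B rule: infinite_finite_induct) (simp_all add: assms)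
  then show "poly.coeff (map_poly f (p * r)) k = poly.coeff (map_poly f p * map_poly f r) k"
    by (simp add: coeff_map_poly assms coeff_mult)
qed

lemma map_poly_prod_hom:
  fixes f :: "'b :: comm_ring_1 \<Rightarrow> 'c :: comm_ring_1"
  assumes "f 0 = 0" "f 1 = 1" "\<And>x y. f (x + y) = f x + f y" "\<And>x y. f (x * y) = f x * f y"
  shows "map_poly f (\<Prod>k\<in>B. p k) = (\<Prod>k\<in>B. map_poly f (p k))"
  by (induction B rule: infinite_finite_induct)
     (simp_all add: map_poly_mult_hom assms)

lemma poly_map_poly_hom:
  fixes f :: "'b :: comm_ring_1 \<Rightarrow> 'c :: comm_ring_1"
  assumes "f 0 = 0" "\<And>x y. f (x + y) = f x + f y" "\<And>x y. f (x * y) = f x * f y"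
  shows "poly (map_poly f p) (f x) = f (poly p x)"
  by (induction p) (simp_all add: map_poly_pCons assms)

lemma degree_map_poly_to_ac [simp]: "degree (map_poly to_ac p) = degree p"
  by (rule degree_map_poly) auto

lemma map_poly_to_ac_eq_iff [simp]: "map_poly to_ac p = map_poly to_ac r \<longleftrightarrow> p = r"
  by (metis coeff_map_poly to_ac_0 to_ac_eq_iff poly_eq_iff)

lemma map_poly_to_ac_eq_0_iff [simp]: "map_poly to_ac p = 0 \<longleftrightarrow> p = 0"
  using map_poly_to_ac_eq_iff[of p 0] by (simp del: map_poly_to_ac_eq_iff)

lemma map_poly_to_ac_mult: "map_poly to_ac (p * r) = map_poly to_ac p * map_poly to_ac r"
  by (rule map_poly_mult_hom) auto

lemma map_poly_to_ac_add: "map_poly to_ac (p + r) = map_poly to_ac p + map_poly to_ac r"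
  by (rule poly_eqI) (simp add: coeff_map_poly)

lemma map_poly_to_ac_diff: "map_poly to_ac (p - r) = map_poly to_ac p - map_poly to_ac r"
  by (rule poly_eqI) (simp add: coeff_map_poly)

text \<open>With \<open>q\<close> the size of the ground field, its elements are \<open>q\<close> roots of \<open>X ^ q - X\<close>, hence all
  the roots.\<close>

lemma power_card_eq_imp_in_range_to_ac:
  fixes x :: "'a :: finite_field alg_closure"
  assumes "x ^ card (UNIV :: 'a set) = x"
  shows "x \<in> range to_ac"
proof (rule ccontr)
  assume x: "x \<notin> range to_ac"
  define r :: "'a alg_closure poly" where "r = monom 1 (card (UNIV :: 'a set)) - monom 1 1"
  have card2: "card (UNIV :: 'a set) \<ge> 2"
    using card_mono[of UNIV "{0, 1 :: 'a}"] by simp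
  have "poly.coeff r (card (UNIV :: 'a set)) = 1"
    using card2 by (simp add: r_def)
  then have r: "r \<noteq> 0" by auto
  have "degree r \<le> card (UNIV :: 'a set)"
    unfolding r_def by (rule degree_diff_le) (use card2 in \<open>auto simp: degree_monom_eq\<close>)
  have "insert x (range to_ac) \<subseteq> {y. poly r y = 0}"
    using assms by (auto simp: r_def poly_monom finite_field_power_card_eq_same simp flip: to_ac_power)
  then have "card (insert x (range (to_ac :: 'a \<Rightarrow> _))) \<le> card {y. poly r y = 0}"
    by (rule card_mono[rotated]) (use r poly_roots_finite in auto)
  also have "\<dots> \<le> degree r"
    by (rule card_poly_roots_bound[OF r])
  also have "\<dots> \<le> card (UNIV :: 'a set)" by fact
  finally show False
    using x by (simp add: card_image inj_to_ac)
qed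

lemma card_degree_less:
  assumes "0 < l"
  shows "finite {p :: 'b :: {finite, comm_ring_1} poly. degree p < l}"
    and "card {p :: 'b :: {finite, comm_ring_1} poly. degree p < l} = card (UNIV :: 'b set) ^ l"
proof -
  have "bij_betw (\<lambda>p. restrict (poly.coeff p) {..<l}) {p :: 'b poly. degree p < l} ({..<l} \<rightarrow>\<^sub>E UNIV)"
  proof (rule bij_betw_byWitness[where f' = "\<lambda>c. \<Sum>k<l. monom (c k) k"])
    show "\<forall>p\<in>{p :: 'b poly. degree p < l}.
        (\<Sum>k<l. monom (restrict (poly.coeff p) {..<l} k) k) = p"
      by (auto simp: poly_eq_iff coeff_sum coeff_eq_0)
    show "\<forall>c\<in>{..<l} \<rightarrow>\<^sub>E (UNIV :: 'b set). restrict (poly.coeff (\<Sum>k<l. monom (c k) k)) {..<l} = c"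
      by (force simp: coeff_sum restrict_def PiE_def extensional_def fun_eq_iff)
    show "(\<lambda>c. \<Sum>k<l. monom (c k) k) ` ({..<l} \<rightarrow>\<^sub>E (UNIV :: 'b set)) \<subseteq> {p. degree p < l}"
    proof clarify
      fix c :: "nat \<Rightarrow> 'b"
      have "degree (\<Sum>k<l. monom (c k) k) \<le> l - 1"
        by (rule degree_sum_le) (auto intro: order.trans[OF degree_monom_le])
      then show "degree (\<Sum>k<l. monom (c k) k) < l" using assms by linarith
    qed
  qed (auto split: if_splits)
  then show "finite {p :: 'b poly. degree p < l}" "card {p :: 'b poly. degree p < l} = card (UNIV :: 'b set) ^ l"
    using bij_betw_finite[of _ "{p :: 'b poly. degree p < l}"] bij_betw_same_card 
    by (force simp: finite_PiE, fastforce simp: card_PiE)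
qed

section \<open>Base-\<open>q\<close> digits\<close>

lemma digit_sum_less:
  assumes "\<And>j. j < l \<Longrightarrow> c j < (b :: nat)"
  shows "(\<Sum>j<l. c j * b ^ j) < b ^ l"
  using assms
proof (induction l)
  case (Suc l)
  then have "(\<Sum>j<l. c j * b ^ j) < b ^ l" by simp
  moreover have "c l * b ^ l \<le> b * b ^ l - b ^ l"
    using mult_le_mono1[of "c l" "b - 1" "b ^ l"] Suc.prems[of l] by (simp add: diff_mult_distrib)
  moreover have "b ^ l \<le> b * b ^ l" using Suc.prems[of l] by simp
  ultimately show ?case unfolding sum.lessThan_Suc power_Suc by linarith
qed simp

lemma digit_sum_inject:
  assumes "\<And>j. j < l \<Longrightarrow> c j < (b :: nat)" "\<And>j. j < l \<Longrightarrow> c' j < b"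
    and "(\<Sum>j<l. c j * b ^ j) = (\<Sum>j<l. c' j * b ^ j)" "j < l"
  shows "c j = c' j"
  using assms
proof (induction l)
  case (Suc l)
  have less: "(\<Sum>j<l. c j * b ^ j) < b ^ l" "(\<Sum>j<l. c' j * b ^ j) < b ^ l"
    using Suc.prems by (auto intro!: digit_sum_less)
  have "b > 0" using Suc.prems(1)[of l] by simp
  have eq: "(\<Sum>j<l. c j * b ^ j) + c l * b ^ l = (\<Sum>j<l. c' j * b ^ j) + c' l * b ^ l"
    using Suc.prems(3) by simp
  have "c l = c' l"
    using arg_cong[OF eq, of "\<lambda>x. x div b ^ l"] less \<open>b > 0\<close> by simp
  moreover have "(\<Sum>j<l. c j * b ^ j) = (\<Sum>j<l. c' j * b ^ j)"
    using arg_cong[OF eq, of "\<lambda>x. x mod b ^ l"] less \<open>b > 0\<close> by simp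
  ultimately show ?case
    using Suc by (auto simp: less_Suc_eq)
qed simp

lemma digit_sum_div_mod: "(\<Sum>j<l. (v div b ^ j mod b) * b ^ j) = v mod (b :: nat) ^ l"
proof (induction l)
  case (Suc l)
  show ?case
    unfolding sum.lessThan_Suc Suc power_Suc2 by (subst mod_mult2_eq) (simp add: algebra_simps)
qed simp

lemma digit_sum_max:
  assumes "0 < (b :: nat)"
  shows "(\<Sum>j<l. (b - 1) * b ^ j) = b ^ l - 1"
proof (induction l)
  case (Suc l)
  have "b ^ l \<ge> 1" "b ^ l \<le> b * b ^ l" using assms by auto
  then show ?case unfolding sum.lessThan_Suc Suc power_Suc unfolding diff_mult_distrib by linarith
qed simp

section \<open>The cyclotomic classes\<close>

locale necklace_setting = necklace_choices q n m s \<omega> g \<phi>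
  for q n m :: nat
    and s :: "nat \<Rightarrow> int"
    and \<omega> :: "'a :: finite_field alg_closure"
    and g :: "nat \<Rightarrow> 'a poly set set"
    and \<phi> :: "nat set \<Rightarrow> (nat \<Rightarrow> int) \<Rightarrow> (nat \<Rightarrow> int)" +
  assumes primepow_q: "primepow q" and card_field: "card (UNIV :: 'a set) = q"
    and n_pos: "0 < n" and coprime_n_q: "coprime n q"
begin

lemma q_ge_2: "2 \<le> q"
  using card_mono[of UNIV "{0, 1 :: 'a}"] card_field by simp

text \<open>The characteristic divides the order p ^ k of the field, so it is p, and q is one of its
  powers.\<close>

lemma frobenius_add:
  fixes x y :: "'a alg_closure"
  shows "(x + y) ^ q = x ^ q + y ^ q"
proof -
  obtain p k where p: "prime p" "q = p ^ k"
    using primepow_q by (auto simp: primepow_def)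
  have "CHAR('a) dvd p ^ k"
    using CHAR_dvd_CARD[where ?'a = 'a] card_field p by simp
  then have "CHAR('a) dvd p"
    by (rule prime_dvd_power[rotated]) simp
  then have "CHAR('a) = p"
    using p(1) by (simp add: primes_dvd_imp_eq)
  then show ?thesis
    by (intro freshmans_dream'[of _ k]) (simp_all add: p)
qed

lemma to_ac_power_q: "to_ac (c :: 'a) ^ q = to_ac c"
  using finite_field_power_card_eq_same[of c] card_field by (simp flip: to_ac_power)

lemma frobenius_fixed_imp_to_ac: "x ^ q = x \<Longrightarrow> x \<in> range (to_ac :: 'a \<Rightarrow> _)"
  using power_card_eq_imp_in_range_to_ac[of x] card_field by simp

lemma frobenius_zero: "(0 :: 'a alg_closure) ^ q = 0"
  using q_ge_2 by simp

lemma frobenius_minus: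
  fixes x :: "'a alg_closure"
  shows "(- x) ^ q = - (x ^ q)"
  using frobenius_add[of x "- x"] frobenius_zero by (simp add: eq_neg_iff_add_eq_0 add.commute)

text \<open>Coefficients from the ground field are fixed by Frobenius; this is why roots come in
  classes closed under z -> q z.\<close>

lemma poly_map_poly_to_ac_power_q: "poly (map_poly to_ac (p :: 'a poly)) (x ^ q) = poly (map_poly to_ac p) x ^ q"
proof -
  have "map_poly (\<lambda>x. x ^ q) (map_poly to_ac p) = map_poly to_ac p"
    using frobenius_zero by (simp add: map_poly_map_poly o_def to_ac_power_q)
  then show ?thesis
    using poly_map_poly_hom[of "\<lambda>x :: 'a alg_closure. x ^ q" "map_poly to_ac p" x]
    by (simp add: frobenius_zero frobenius_add power_mult_distrib)
qed

lemma \<omega>_nonzero: "\<omega> \<noteq> 0"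
  using primitive_root(1) n_pos by (auto simp: power_0_left)

lemma \<omega>_powi_mod: "\<omega> powi (k mod int n) = \<omega> powi k"
proof -
  have "\<omega> powi k = \<omega> powi (int n * (k div int n) + k mod int n)" by simp
  also have "\<dots> = (\<omega> powi int n) powi (k div int n) * \<omega> powi (k mod int n)"
    using \<omega>_nonzero by (metis power_int_add power_int_mult)
  finally show ?thesis by (simp add: primitive_root(1))
qed

lemma \<omega>_powi_eq_iff: "\<omega> powi j = \<omega> powi k \<longleftrightarrow> [j = k] (mod int n)"
proof
  assume "\<omega> powi j = \<omega> powi k"
  then have "\<omega> powi (j - k) = 1"
    using \<omega>_nonzero by (simp add: power_int_diff)
  then have *: "\<omega> ^ nat ((j - k) mod int n) = 1"
    using n_pos by (metis \<omega>_powi_mod pos_mod_sign of_nat_0_less_iff power_int_nonneg_exp)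
  have "nat ((j - k) mod int n) < n"
    using n_pos pos_mod_bound[of "int n" "j - k"] by linarith
  then have "nat ((j - k) mod int n) = 0"
    using primitive_root(2) * by blast
  moreover have "0 \<le> (j - k) mod int n"
    using n_pos by simp
  ultimately have "(j - k) mod int n = 0" by linarith
  then show "[j = k] (mod int n)"
    by (simp add: cong_iff_dvd_diff dvd_eq_mod_eq_0)
next
  assume "[j = k] (mod int n)"
  then show "\<omega> powi j = \<omega> powi k"
    by (metis \<omega>_powi_mod cong_def)
qed

lemma \<omega>_powi_power: "(\<omega> powi k) ^ j = \<omega> powi (int j * k)"
  by (simp add: power_int_power' mult.commute)

lemma Zn_eq: "Zn = {0..<int n}"
  using n_pos by (simp add: Zn_def carrier_integer_mod_group)

lemma mod_in_Zn [simp]: "k mod int n \<in> Zn"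
  using n_pos by (simp add: Zn_eq)

lemma mod_Zn: "z \<in> Zn \<Longrightarrow> z mod int n = z"
  by (simp add: Zn_eq)

lemma coprime_power_q: "coprime (int q ^ j) (int n)"
  using coprime_n_q by (simp add: coprime_commute)

text \<open>Euler's theorem supplies the exponent \<open>totient n\<close>, so the
  \<open>LEAST\<close> in \<open>\<l>\<close> is attained.\<close>

lemma \<l>_pos: "0 < \<l> i" and \<l>_cong: "[int q ^ \<l> i * s i = s i] (mod int n)"
proof -
  have "[q ^ totient n = 1] (mod n)"
    using coprime_n_q by (intro euler_theorem) (simp add: coprime_commute)
  then have "[int q ^ totient n = 1] (mod int n)"
    by (metis cong_int_iff of_nat_1 of_nat_power)
  then have "[int q ^ totient n * s i = 1 * s i] (mod int n)"
    by (rule cong_scalar_right)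
  then have "0 < totient n \<and> [int q ^ totient n * s i = s i] (mod int n)"
    using n_pos by simp
  then have "0 < \<l> i \<and> [int q ^ \<l> i * s i = s i] (mod int n)"
    unfolding \<l>_def by (rule LeastI)
  then show "0 < \<l> i" "[int q ^ \<l> i * s i = s i] (mod int n)" by auto
qed

lemma \<l>_least: "0 < k \<Longrightarrow> [int q ^ k * s i = s i] (mod int n) \<Longrightarrow> \<l> i \<le> k"
  unfolding \<l>_def by (rule Least_le) simp

lemma q_power_\<l>_ge_2: "2 \<le> q ^ \<l> i"
  using q_ge_2 \<l>_pos[of i] self_le_power[of q "\<l> i"] by linarith

lemma elt_in_Zn [simp]: "elt i j \<in> Zn"
  by (simp add: elt_def)

lemma inj_on_elt: "inj_on (elt i) {0..<\<l> i}"
proof (rule linorder_inj_onI')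
  fix j k assume jk: "j \<in> {0..<\<l> i}" "k \<in> {0..<\<l> i}" "j < k"
  show "elt i j \<noteq> elt i k"
  proof
    assume "elt i j = elt i k"
    then have "[int q ^ j * (int q ^ (k - j) * s i) = int q ^ j * s i] (mod int n)"
      using jk by (simp add: elt_def cong_def mult.assoc[symmetric] flip: power_add)
    then have "[int q ^ (k - j) * s i = s i] (mod int n)"
      using coprime_power_q by (subst (asm) cong_mult_lcancel) auto
    then show False
      using \<l>_least[of "k - j" i] jk by auto
  qed
qed

lemma finite_S: "finite (S i)" and card_S: "card (S i) = \<l> i"
  by (simp_all add: S_def card_image inj_on_elt)

lemma S_subset_Zn: "S i \<subseteq> Zn"
  by (auto simp: S_def)

lemma elt_Suc: "elt i (Suc j) = (int q * elt i j) mod int n"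
  by (simp add: elt_def mod_mult_right_eq mult.assoc)

lemma elt_add_\<l>: "elt i (j + \<l> i) = elt i j"
  using cong_scalar_left[OF \<l>_cong, of "int q ^ j" i]
  by (simp add: elt_def cong_def power_add mult.assoc)

lemma elt_in_S: "elt i j \<in> S i"
proof (induction j rule: less_induct)
  case (less j)
  show ?case
  proof (cases "j < \<l> i")
    case False
    then have "elt i j = elt i (j - \<l> i)"
      using elt_add_\<l>[of i "j - \<l> i"] by simp
    then show ?thesis
      using less.IH[of "j - \<l> i"] False \<l>_pos[of i] by simp
  qed (auto simp: S_def)
qed

text \<open>Both directions are needed because \<open>equivclp\<close> also follows the generating
  relation backwards.\<close>

lemma q_mult_in_S_iff:
  assumes "z \<in> Zn"
  shows "(int q * z) mod int n \<in> S i \<longleftrightarrow> z \<in> S i"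
proof
  assume "z \<in> S i"
  then obtain j where "z = elt i j" by (auto simp: S_def)
  then have "(int q * z) mod int n = elt i (Suc j)" by (simp add: elt_Suc)
  then show "(int q * z) mod int n \<in> S i" by (simp add: elt_in_S)
next
  assume "(int q * z) mod int n \<in> S i"
  then obtain j where "(int q * z) mod int n = elt i j" by (auto simp: S_def)
  \<comment> \<open>One extra turn around the cycle provides a predecessor even for
    \<open>j = 0\<close>.\<close>
  also have "elt i j = elt i (Suc (j + \<l> i - 1))"
    using elt_add_\<l>[of i j] \<l>_pos[of i] by simp
  finally have "[int q * z = int q * elt i (j + \<l> i - 1)] (mod int n)"
    by (simp add: elt_Suc cong_def)
  then have "[z = elt i (j + \<l> i - 1)] (mod int n)"
    using coprime_power_q[of 1] by (subst (asm) cong_mult_lcancel) auto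
  then have "z = elt i (j + \<l> i - 1)"
    using mod_Zn[OF assms] mod_Zn[OF elt_in_Zn] by (simp add: cong_def)
  then show "z \<in> S i" by (simp add: elt_in_S)
qed

lemma bij_q_mult_S: "bij_betw (\<lambda>z. (int q * z) mod int n) (S i) (S i)"
proof (rule bij_betw_imageI)
  show inj: "inj_on (\<lambda>z. (int q * z) mod int n) (S i)"
  proof (rule inj_onI)
    fix z w assume zw: "z \<in> S i" "w \<in> S i" "(int q * z) mod int n = (int q * w) mod int n"
    then have "[z = w] (mod int n)"
      using coprime_power_q[of 1] cong_mult_lcancel[of "int q" "int n" z w] by (simp add: cong_def)
    then show "z = w"
      using zw S_subset_Zn mod_Zn by (metis cong_def subsetD)
  qed
  have "(\<lambda>z. (int q * z) mod int n) ` S i \<subseteq> S i"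
    using q_mult_in_S_iff S_subset_Zn by blast
  then show "(\<lambda>z. (int q * z) mod int n) ` S i = S i"
    using inj by (rule endo_inj_surj[OF finite_S])
qed

lemma qrel_class: "qrel `` {s i mod int n} = S i"
proof (intro equalityI subsetI)
  fix z assume "z \<in> qrel `` {s i mod int n}"
  then have "equivclp (\<lambda>x y. x \<in> Zn \<and> y = (int q * x) mod int n) (s i mod int n) z"
    by (simp add: qrel_def)
  then show "z \<in> S i"
  proof (induction rule: equivclp_induct)
    case base
    show ?case using elt_in_S[of i 0] by (simp add: elt_def)
  next
    case (step y z)
    then show ?case using q_mult_in_S_iff by auto
  qed
next
  fix z assume "z \<in> S i"
  then obtain j where "z = elt i j" by (auto simp: S_def)
  moreover have "equivclp (\<lambda>x y. x \<in> Zn \<and> y = (int q * x) mod int n) (s i mod int n) (elt i j)"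
  proof (induction j)
    case (Suc j)
    then show ?case by (rule equivclp_into_equivclp) (simp add: elt_Suc)
  qed (simp add: elt_def)
  ultimately show "z \<in> qrel `` {s i mod int n}" by (simp add: qrel_def)
qed

lemma equiv_qrel: "equiv Zn qrel"
  by (rule equivI) (auto simp: qrel_def refl_on_def sym_def trans_def
      intro: equivclp_sym equivclp_trans)

lemma S_cover: "z \<in> Zn \<Longrightarrow> \<exists>i\<in>{1..m}. z \<in> S i"
proof -
  assume z: "z \<in> Zn"
  have "(\<lambda>i. qrel `` {s i mod int n}) ` {1..m} = Zn // qrel"
    using representatives by (rule bij_betw_imp_surj_on)
  then have "qrel `` {z} \<in> S ` {1..m}"
    using quotientI[OF z, of qrel] by (simp add: qrel_class)
  moreover have "z \<in> qrel `` {z}"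
    using equiv_qrel z by (rule equiv_class_self)
  ultimately show ?thesis by auto
qed

lemma S_disjoint:
  assumes "i \<in> {1..m}" "k \<in> {1..m}" "z \<in> S i" "z \<in> S k"
  shows "i = k"
proof -
  have "qrel `` {s i mod int n} = qrel `` {s k mod int n}"
    using assms(3,4) unfolding qrel_class[symmetric] Image_singleton_iff
    by (metis equiv_qrel equiv_class_eq)
  then show ?thesis
    using assms representatives by (auto simp: bij_betw_def dest: inj_onD)
qed

section \<open>Residues modulo the cyclotomic factors\<close>

text \<open>Reduction modulo \<open>P i\<close> amounts to evaluation at \<open>\<omega> powi s i\<close>, which turns every
  statement about the quotient rings into one about values in the algebraic closure.\<close>

definition ev :: "nat \<Rightarrow> 'a poly \<Rightarrow> 'a alg_closure" where
  "ev i p = poly (map_poly to_ac p) (\<omega> powi s i)"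

lemma ev_simps [simp]:
  "ev i 0 = 0" "ev i 1 = 1"
  "ev i (p * r) = ev i p * ev i r"
  "ev i (p + r) = ev i p + ev i r"
  "ev i (p - r) = ev i p - ev i r"
  by (simp_all add: ev_def map_poly_to_ac_mult map_poly_to_ac_add map_poly_to_ac_diff)

lemma ev_power [simp]: "ev i (p ^ k) = ev i p ^ k"
  by (induction k) simp_all

lemma ev_prod: "ev i (\<Prod>k\<in>B. p k) = (\<Prod>k\<in>B. ev i (p k))"
  by (induction B rule: infinite_finite_induct) simp_all

lemma ev_sum: "ev i (\<Sum>k\<in>B. p k) = (\<Sum>k\<in>B. ev i (p k))"
  by (induction B rule: infinite_finite_induct) simp_all

lemma ev_monom: "ev i (monom 1 k) = \<omega> powi (int k * s i)"
  by (simp add: ev_def map_poly_monom poly_monom \<omega>_powi_power)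

text \<open>The powers of \<omega> indexed by \<open>S i\<close> are Frobenius conjugates, so the
  value at one of them determines the values at all.\<close>

lemma ev_elt: "poly (map_poly to_ac p) (\<omega> powi elt i j) = ev i p ^ (q ^ j)"
proof (induction j)
  case 0
  show ?case by (simp add: ev_def elt_def \<omega>_powi_mod)
next
  case (Suc j)
  have "\<omega> powi elt i (Suc j) = (\<omega> powi elt i j) ^ q"
    by (simp add: elt_Suc \<omega>_powi_mod \<omega>_powi_power)
  then show ?case
    by (simp add: poly_map_poly_to_ac_power_q Suc flip: power_mult) (simp add: mult.commute)
qed

text \<open>The cycle of conjugates closes after \<open>\<l> i\<close> steps; the values thus lie in
  the field with \<open>q ^ \<l> i\<close> elements.\<close>

lemma ev_power_q_\<l>: "ev i p ^ (q ^ \<l> i) = ev i p"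
  using ev_elt[of p i "\<l> i"] ev_elt[of p i 0] elt_add_\<l>[of i 0] by simp

lemma ev_power_eq_1: "ev i p \<noteq> 0 \<Longrightarrow> ev i p ^ (q ^ \<l> i - 1) = 1"
  using ev_power_q_\<l>[of i p] q_power_\<l>_ge_2[of i]
  by (metis Suc_diff_1 le_zero_eq mult_cancel_left1 not_gr_zero power_Suc zero_neq_numeral)

lemma inj_on_\<omega>_powi: "inj_on (\<lambda>k. \<omega> powi k) Zn"
  by (rule inj_onI) (metis \<omega>_powi_eq_iff cong_def mod_Zn)

definition PS :: "nat \<Rightarrow> 'a alg_closure poly" where
  "PS i = (\<Prod>k\<in>S i. [:- (\<omega> powi k), 1:])"

text \<open>Frobenius permutes the linear factors, hence fixes the coefficients of the product,
  which therefore come from the ground field. Injectivity of \<open>to_ac\<close> then justifies the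
  \<open>THE\<close> in \<open>P\<close>.\<close>

lemma map_poly_to_ac_P: "map_poly to_ac (P i) = PS i"
proof -
  have "map_poly (\<lambda>x. x ^ q) (PS i) = (\<Prod>k\<in>S i. map_poly (\<lambda>x. x ^ q) [:- (\<omega> powi k), 1:])"
    unfolding PS_def using frobenius_zero frobenius_add
    by (intro map_poly_prod_hom) (simp_all add: power_mult_distrib)
  also have "\<dots> = (\<Prod>k\<in>S i. [:- (\<omega> powi ((int q * k) mod int n)), 1:])"
    using frobenius_zero
    by (simp add: map_poly_pCons frobenius_minus \<omega>_powi_mod \<omega>_powi_power)
  also have "\<dots> = PS i"
    unfolding PS_def by (rule prod.reindex_bij_betw[OF bij_q_mult_S])
  finally have "poly.coeff (PS i) k \<in> range to_ac" for k
    using frobenius_zero by (metis coeff_map_poly frobenius_fixed_imp_to_ac)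
  then have "map_poly to_ac (map_poly of_ac (PS i)) = PS i"
    by (intro poly_eqI) (simp add: coeff_map_poly to_ac_of_ac)
  then have "\<exists>!p. map_poly to_ac p = PS i"
    by (metis map_poly_to_ac_eq_iff)
  then show ?thesis
    unfolding P_def PS_def by (rule theI')
qed

lemma PS_nonzero: "PS i \<noteq> 0"
  by (simp add: PS_def finite_S)

lemma degree_P: "degree (P i) = \<l> i"
proof -
  have "degree (P i) = degree (PS i)"
    by (simp flip: map_poly_to_ac_P)
  also have "\<dots> = \<l> i"
    unfolding PS_def by (subst degree_prod_eq_sum_degree) (simp_all add: card_S)
  finally show ?thesis .
qed

lemma P_nonzero: "P i \<noteq> 0"
  using PS_nonzero[of i] by (simp flip: map_poly_to_ac_P)

lemma ev_P: "ev i (P i) = 0"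
proof -
  have "\<omega> powi elt i 0 = \<omega> powi s i"
    by (simp add: elt_def \<omega>_powi_mod)
  then have "poly [:- (\<omega> powi elt i 0), 1:] (\<omega> powi s i) = 0"
    by simp
  then have "\<exists>k\<in>S i. poly [:- (\<omega> powi k), 1:] (\<omega> powi s i) = 0"
    using elt_in_S by blast
  then show ?thesis
    by (simp only: ev_def map_poly_to_ac_P PS_def poly_prod prod_zero_iff[OF finite_S])
qed

lemma ev_P_other:
  assumes "i \<in> {1..m}" "k \<in> {1..m}" "i \<noteq> k"
  shows "ev i (P k) \<noteq> 0"
proof
  assume "ev i (P k) = 0"
  then have "\<exists>z\<in>S k. poly [:- (\<omega> powi z), 1:] (\<omega> powi s i) = 0"
    by (simp only: ev_def map_poly_to_ac_P PS_def poly_prod prod_zero_iff[OF finite_S])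
  then obtain z where z: "z \<in> S k" "\<omega> powi elt i 0 = \<omega> powi z"
    by (auto simp: elt_def \<omega>_powi_mod)
  then have "elt i 0 = z"
    using S_subset_Zn by (intro inj_onD[OF inj_on_\<omega>_powi]) auto
  then show False
    using S_disjoint[OF assms(1,2), of z] z elt_in_S assms(3) by auto
qed

text \<open>A zero at one conjugate is a zero at all \<open>\<l> i\<close> of them, too many for the
  degree. So \<open>P i\<close> is the minimal polynomial of \<omega> ^ \<open>s i\<close>.\<close>

lemma degree_less_\<l>_ev_eq_0:
  assumes "degree p < \<l> i" "ev i p = 0"
  shows "p = 0"
proof (rule ccontr)
  assume "p \<noteq> 0"
  have "(\<lambda>k. \<omega> powi k) ` S i \<subseteq> {x. poly (map_poly to_ac p) x = 0}"
    using assms(2) q_ge_2 by (auto simp: S_def ev_elt)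
  then have "card ((\<lambda>k. \<omega> powi k) ` S i) \<le> card {x. poly (map_poly to_ac p) x = 0}"
    by (rule card_mono[rotated]) (use \<open>p \<noteq> 0\<close> in \<open>simp add: poly_roots_finite\<close>)
  also have "\<dots> \<le> degree p"
    using card_poly_roots_bound[of "map_poly to_ac p"] \<open>p \<noteq> 0\<close> by simp
  finally show False
    using assms(1) by (simp add: card_image card_S inj_on_subset[OF inj_on_\<omega>_powi S_subset_Zn])
qed

lemma degree_mod_P: "degree (p mod P i) < \<l> i"
  using degree_mod_less[OF P_nonzero, of p i] \<l>_pos[of i] by (auto simp: degree_P)

lemma ev_mod_P: "ev i (p mod P i) = ev i p"
proof -
  have "ev i p = ev i (p div P i * P i + p mod P i)" by simp
  then show ?thesis by (simp only: ev_simps ev_P mult_zero_right add_0_left)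
qed

lemma P_dvd_iff: "P i dvd p \<longleftrightarrow> ev i p = 0"
proof
  assume "ev i p = 0"
  then have "p mod P i = 0"
    by (intro degree_less_\<l>_ev_eq_0[OF degree_mod_P]) (simp add: ev_mod_P)
  then show "P i dvd p" by auto
qed (auto elim!: dvdE simp: ev_P)

section \<open>The modulus X ^ n - 1\<close>

abbreviation Xn1 :: "'a poly" where
  "Xn1 \<equiv> monom 1 n - 1"

lemma degree_Xn1: "degree Xn1 = n"
proof -
  have "degree (monom 1 n + (- 1 :: 'a poly)) = degree (monom (1 :: 'a) n)"
    using n_pos by (intro degree_add_eq_left) (simp add: degree_monom_eq)
  then show ?thesis by (simp add: degree_monom_eq)
qed

lemma Xn1_nonzero: "Xn1 \<noteq> 0"
  using degree_Xn1 n_pos by auto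

lemma ev_Xn1: "ev i Xn1 = 0"
proof -
  have "\<omega> powi (int n * s i) = \<omega> powi 0"
    unfolding \<omega>_powi_eq_iff by (simp add: cong_0_iff)
  then show ?thesis by (simp add: ev_monom)
qed

text \<open>The classes cover \<open>Zn\<close>, so the remainder modulo X ^ n - 1 vanishes at n
  distinct powers of \<omega>, although its degree is below n. This is the injective half of Chinese
  remaindering.\<close>

lemma Xn1_dvd_iff: "Xn1 dvd p \<longleftrightarrow> (\<forall>i\<in>{1..m}. ev i p = 0)"
proof
  assume ev0: "\<forall>i\<in>{1..m}. ev i p = 0"
  define r where "r = p mod Xn1"
  have ev_r: "ev i r = ev i p" for i
  proof -
    have "ev i p = ev i (p div Xn1 * Xn1 + p mod Xn1)"
      by (simp only: div_mult_mod_eq)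
    then show ?thesis unfolding r_def by (simp only: ev_simps(3,4) ev_Xn1 mult_zero_right add_0_left)
  qed
  have deg: "degree r < n"
    using degree_mod_less[OF Xn1_nonzero, of p] n_pos unfolding r_def degree_Xn1 by auto
  have "r = 0"
  proof (rule ccontr)
    assume "r \<noteq> 0"
    have "poly (map_poly to_ac r) (\<omega> powi z) = 0" if z: "z \<in> Zn" for z
    proof -
      obtain i where i: "i \<in> {1..m}" "z \<in> S i"
        using S_cover z by blast
      then obtain j where "z = elt i j" by (auto simp: S_def)
      then show ?thesis
        using ev0 i q_ge_2 by (simp add: ev_elt ev_r)
    qed
    then have "(\<lambda>k. \<omega> powi k) ` Zn \<subseteq> {x. poly (map_poly to_ac r) x = 0}" by blast
    then have "card ((\<lambda>k. \<omega> powi k) ` Zn) \<le> card {x. poly (map_poly to_ac r) x = 0}"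
      by (rule card_mono[rotated]) (use \<open>r \<noteq> 0\<close> in \<open>simp add: poly_roots_finite\<close>)
    also have "\<dots> \<le> degree r"
      using card_poly_roots_bound[of "map_poly to_ac r"] \<open>r \<noteq> 0\<close> by simp
    finally show False
      using deg by (simp add: card_image inj_on_\<omega>_powi Zn_eq[symmetric]) (simp add: Zn_eq)
  qed
  then show "Xn1 dvd p" unfolding r_def by auto
qed (auto elim!: dvdE simp: ev_Xn1 simp del: ev_simps(5))

text \<open>Remainders modulo \<open>P i\<close> suffice to reach every value, and
  \<open>ev i\<close> is injective on them.\<close>

lemma card_range_ev: "card (range (ev i)) = q ^ \<l> i"
proof -
  have range: "range (ev i) = ev i ` {p. degree p < \<l> i}"
  proof (intro equalityI subsetI)
    fix x assume "x \<in> range (ev i)"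
    then obtain p where "x = ev i p" by auto
    then show "x \<in> ev i ` {p. degree p < \<l> i}"
      using degree_mod_P by (intro image_eqI[of _ _ "p mod P i"]) (simp_all add: ev_mod_P)
  qed auto
  have inj: "inj_on (ev i) {p. degree p < \<l> i}"
  proof (rule inj_onI)
    fix p r assume pr: "p \<in> {p. degree p < \<l> i}" "r \<in> {p. degree p < \<l> i}" "ev i p = ev i r"
    have "degree (p - r) < \<l> i"
      using pr degree_diff_le_max[of p r] by auto
    then show "p = r"
      using degree_less_\<l>_ev_eq_0[of "p - r" i] pr by simp
  qed
  show ?thesis
    using inj card_degree_less(2)[OF \<l>_pos[of i], where ?'b = 'a]
    by (simp add: range card_image card_field)
qed

section \<open>The quotient rings\<close>

text \<open>Both the order of the cyclic group \<open>G i\<close> and the value of the digit word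
  with all entries \<open>q - 1\<close>.\<close>

definition \<mu> :: "nat \<Rightarrow> nat" where
  "\<mu> i = q ^ \<l> i - 1"

lemma \<mu>_pos: "0 < \<mu> i" and q_power_\<l>_eq: "q ^ \<l> i = Suc (\<mu> i)"
  using q_power_\<l>_ge_2[of i] by (simp_all add: \<mu>_def)

lemma ev_power_\<mu>: "ev i p \<noteq> 0 \<Longrightarrow> ev i p ^ \<mu> i = 1"
  using ev_power_eq_1 by (simp add: \<mu>_def)

lemma PR_simps [simp]:
  "carrier PR = UNIV" "x \<otimes>\<^bsub>PR\<^esub> y = x * y" "x \<oplus>\<^bsub>PR\<^esub> y = x + y" "\<one>\<^bsub>PR\<^esub> = 1" "\<zero>\<^bsub>PR\<^esub> = 0"
  by (simp_all add: PR_def ring_of_type_algebra_def)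

lemma cring_PR: "cring PR"
  unfolding PR_def by (rule cring_from_type_algebra)

lemma ideal_PR: "ideal (PIdl\<^bsub>PR\<^esub> Xn1) PR"
  by (rule cring.cgenideal_ideal[OF cring_PR]) simp

lemma PR_minus: "x \<ominus>\<^bsub>PR\<^esub> y = x - y"
proof -
  interpret PR: cring PR by (rule cring_PR)
  have "\<ominus>\<^bsub>PR\<^esub> y = - y" by (rule PR.minus_equality) simp_all
  then show ?thesis by (simp add: a_minus_def)
qed

lemma to_Q_eq_iff: "to_Q p = to_Q r \<longleftrightarrow> (\<forall>i\<in>{1..m}. ev i p = ev i r)"
proof -
  interpret PR: cring PR by (rule cring_PR)
  have "to_Q p = to_Q r \<longleftrightarrow> p \<ominus>\<^bsub>PR\<^esub> r \<in> PIdl\<^bsub>PR\<^esub> Xn1"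
    unfolding to_Q_def using PR.quotient_eq_iff_same_a_r_cos[OF ideal_PR, of p r] by simp
  also have "\<dots> \<longleftrightarrow> Xn1 dvd p - r"
    by (auto simp: cgenideal_def PR_minus dvd_def mult.commute)
  also have "\<dots> \<longleftrightarrow> (\<forall>i\<in>{1..m}. ev i p = ev i r)"
    by (subst Xn1_dvd_iff) simp
  finally show ?thesis .
qed

lemma cring_Q: "cring \<Q>"
  unfolding \<Q>_def by (rule ideal.quotient_is_cring[OF ideal_PR cring_PR])

lemma ring_hom_to_Q: "to_Q \<in> ring_hom PR \<Q>"
  unfolding \<Q>_def to_Q_def using ideal.rcos_ring_hom[OF ideal_PR] .

lemma to_Q_simps:
  "to_Q p \<in> carrier \<Q>" "to_Q p \<otimes>\<^bsub>\<Q>\<^esub> to_Q r = to_Q (p * r)" "to_Q p \<oplus>\<^bsub>\<Q>\<^esub> to_Q r = to_Q (p + r)"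
  "\<one>\<^bsub>\<Q>\<^esub> = to_Q 1"
  using ring_hom_closed[OF ring_hom_to_Q, of p] ring_hom_mult[OF ring_hom_to_Q, of p r]
    ring_hom_add[OF ring_hom_to_Q, of p r] ring_hom_one[OF ring_hom_to_Q]
  by simp_all

lemma carrier_Q: "carrier \<Q> = range to_Q"
  by (auto simp: \<Q>_def to_Q_def FactRing_def A_RCOSETS_def')

lemma to_Q_power: "to_Q p [^]\<^bsub>\<Q>\<^esub> k = to_Q (p ^ k)"
proof -
  interpret Q: cring \<Q> by (rule cring_Q)
  show ?thesis by (induction k) (simp_all add: to_Q_simps mult.commute)
qed

lemma to_Q_minus: "to_Q p \<ominus>\<^bsub>\<Q>\<^esub> to_Q r = to_Q (p - r)"
proof -
  interpret Q: cring \<Q> by (rule cring_Q)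
  have "\<zero>\<^bsub>\<Q>\<^esub> = to_Q 0"
    using Q.l_zero[of "to_Q 0"] Q.add.r_cancel_one[of "to_Q 0" "to_Q 0"] by (simp add: to_Q_simps)
  then have "\<ominus>\<^bsub>\<Q>\<^esub> to_Q r = to_Q (- r)"
    by (intro Q.minus_equality) (simp_all add: to_Q_simps)
  then show ?thesis by (simp add: a_minus_def to_Q_simps)
qed

lemma PQ_divides_iff:
  assumes "i \<in> {1..m}"
  shows "PQ i divides\<^bsub>\<Q>\<^esub> to_Q p \<longleftrightarrow> ev i p = 0"
proof
  assume "PQ i divides\<^bsub>\<Q>\<^esub> to_Q p"
  then obtain r where "to_Q p = to_Q (P i * r)"
    by (auto simp: factor_def carrier_Q PQ_def to_Q_simps)
  then show "ev i p = 0"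
    using assms ev_P by (auto simp: to_Q_eq_iff)
next
  assume "ev i p = 0"
  then obtain r where "p = P i * r"
    by (auto simp flip: P_dvd_iff)
  then have "to_Q p = PQ i \<otimes>\<^bsub>\<Q>\<^esub> to_Q r" by (simp add: PQ_def to_Q_simps)
  then show "PQ i divides\<^bsub>\<Q>\<^esub> to_Q p"
    unfolding factor_def using to_Q_simps(1) by blast
qed

lemma ideal_Q: "ideal (PIdl\<^bsub>\<Q>\<^esub> (PQ i)) \<Q>"
  by (rule cring.cgenideal_ideal[OF cring_Q]) (simp add: PQ_def to_Q_simps)

definition res :: "nat \<Rightarrow> 'a poly \<Rightarrow> 'a poly set set" where
  "res i p = to_K i (to_Q p)"

lemma res_eq_iff:
  assumes "i \<in> {1..m}"
  shows "res i p = res i r \<longleftrightarrow> ev i p = ev i r"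
proof -
  interpret Q: cring \<Q> by (rule cring_Q)
  have "res i p = res i r \<longleftrightarrow> to_Q p \<ominus>\<^bsub>\<Q>\<^esub> to_Q r \<in> PIdl\<^bsub>\<Q>\<^esub> (PQ i)"
    unfolding res_def to_K_def
    using Q.quotient_eq_iff_same_a_r_cos[OF ideal_Q, of "to_Q p" "to_Q r"] by (simp add: to_Q_simps)
  also have "\<dots> \<longleftrightarrow> PQ i divides\<^bsub>\<Q>\<^esub> to_Q (p - r)"
    using Q.m_comm by (auto simp: cgenideal_def factor_def to_Q_minus PQ_def to_Q_simps(1))
  finally show ?thesis
    by (simp add: PQ_divides_iff[OF assms])
qed

lemma cring_K: "cring (K i)"
  unfolding K_def by (rule ideal.quotient_is_cring[OF ideal_Q cring_Q])

lemma ring_hom_to_K: "to_K i \<in> ring_hom \<Q> (K i)"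
  unfolding K_def to_K_def using ideal.rcos_ring_hom[OF ideal_Q] .

lemma res_simps:
  "res i p \<in> carrier (K i)" "res i p \<otimes>\<^bsub>K i\<^esub> res i r = res i (p * r)" "\<one>\<^bsub>K i\<^esub> = res i 1"
  using ring_hom_closed[OF ring_hom_to_K, of "to_Q p" i]
    ring_hom_mult[OF ring_hom_to_K, of "to_Q p" "to_Q r" i] ring_hom_one[OF ring_hom_to_K, of i]
  by (simp_all add: res_def to_Q_simps)

lemma carrier_K: "carrier (K i) = range (res i)"
  by (auto simp: K_def res_def to_K_def FactRing_def A_RCOSETS_def' carrier_Q)

lemma res_power: "res i p [^]\<^bsub>K i\<^esub> k = res i (p ^ k)"
proof -
  interpret K: cring "K i" by (rule cring_K)
  show ?thesis by (induction k) (simp_all add: res_simps mult.commute)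
qed

lemma res_unit_iff:
  assumes "i \<in> {1..m}"
  shows "res i p \<in> Units (K i) \<longleftrightarrow> ev i p \<noteq> 0"
proof
  assume "res i p \<in> Units (K i)"
  then obtain r where "res i (p * r) = res i 1"
    by (auto simp: Units_def carrier_K res_simps)
  then show "ev i p \<noteq> 0" using assms by (auto simp: res_eq_iff)
next
  assume nz: "ev i p \<noteq> 0"
  \<comment> \<open>The inverse of \<open>p\<close> is itself a power of \<open>p\<close>, so no
    Bezout coefficients are required.\<close>
  have inv: "ev i (p ^ (\<mu> i - 1) * p) = 1"
    unfolding ev_simps ev_power power_minus_mult[OF \<mu>_pos] by (rule ev_power_\<mu>[OF nz])
  then have "res i (p ^ (\<mu> i - 1)) \<otimes>\<^bsub>K i\<^esub> res i p = \<one>\<^bsub>K i\<^esub>"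
    and "res i p \<otimes>\<^bsub>K i\<^esub> res i (p ^ (\<mu> i - 1)) = \<one>\<^bsub>K i\<^esub>"
    using assms by (simp_all add: res_simps res_eq_iff mult.commute)
  then show "res i p \<in> Units (K i)"
    unfolding Units_def using res_simps(1) by blast
qed

lemma carrier_G: "i \<in> {1..m} \<Longrightarrow> carrier (G i) = res i ` {p. ev i p \<noteq> 0}"
  using res_unit_iff by (auto simp: G_def units_of_carrier carrier_K Units_def)

section \<open>Discrete logarithms in the algebraic closure\<close>

definition \<gamma> :: "nat \<Rightarrow> 'a poly" where
  "\<gamma> i = (SOME p. g i = res i p)"

lemma
  assumes "i \<in> {1..m}"
  shows g_eq: "g i = res i (\<gamma> i)" and ev_\<gamma>_nonzero: "ev i (\<gamma> i) \<noteq> 0"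
proof -
  have "\<exists>p. g i = res i p"
    using generator(1)[OF assms] by (auto simp: carrier_G[OF assms])
  then show g: "g i = res i (\<gamma> i)"
    unfolding \<gamma>_def by (rule someI_ex)
  then show "ev i (\<gamma> i) \<noteq> 0"
    using generator(1)[OF assms] res_unit_iff[OF assms] by (simp add: G_def units_of_carrier)
qed

lemma g_power:
  assumes "i \<in> {1..m}"
  shows "g i [^]\<^bsub>G i\<^esub> k = res i (\<gamma> i ^ k)"
proof -
  interpret K: cring "K i" by (rule cring_K)
  show ?thesis
    using K.units_of_pow[of "g i" k] res_unit_iff[OF assms] ev_\<gamma>_nonzero[OF assms]
    by (simp add: G_def g_eq[OF assms] res_power)
qed

definition \<theta> :: "nat \<Rightarrow> 'a alg_closure" where
  "\<theta> i = ev i (\<gamma> i)"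

lemma \<theta>_nonzero: "i \<in> {1..m} \<Longrightarrow> \<theta> i \<noteq> 0"
  by (simp add: \<theta>_def ev_\<gamma>_nonzero)

lemma \<theta>_power_eq_1: "i \<in> {1..m} \<Longrightarrow> \<theta> i ^ \<mu> i = 1"
  unfolding \<theta>_def by (intro ev_power_\<mu> ev_\<gamma>_nonzero)

lemma \<theta>_power_mod: "i \<in> {1..m} \<Longrightarrow> \<theta> i ^ (k mod \<mu> i) = \<theta> i ^ k"
proof -
  assume i: "i \<in> {1..m}"
  have "\<theta> i ^ k = (\<theta> i ^ \<mu> i) ^ (k div \<mu> i) * \<theta> i ^ (k mod \<mu> i)"
    unfolding power_mult[symmetric] power_add[symmetric] by simp
  then show ?thesis by (simp add: \<theta>_power_eq_1[OF i])
qed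

lemma ev_eq_\<theta>_power:
  assumes i: "i \<in> {1..m}" and "ev i p \<noteq> 0"
  shows "\<exists>k. ev i p = \<theta> i ^ k"
proof -
  interpret G: group "G i"
    unfolding G_def using cring_K by (intro monoid.units_group) (simp add: cring_def ring_def)
  \<comment> \<open>\<open>generate\<close> allows inverses; in a finite group natural exponents
    suffice, and \<open>dlog\<close> ranges over these.\<close>
  have "finite (carrier (G i))"
  proof (rule finite_subset)
    have "res i p = res i (p mod P i)" for p
      by (simp add: res_eq_iff[OF i] ev_mod_P)
    then show "carrier (G i) \<subseteq> res i ` {p. degree p < \<l> i}"
      using degree_mod_P unfolding carrier_G[OF i] by blast
  qed (simp add: card_degree_less[OF \<l>_pos])
  then have "carrier (G i) = {g i [^]\<^bsub>G i\<^esub> k |k. k \<in> (UNIV :: nat set)}"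
    using G.generate_pow_on_finite_carrier generator(1,2)[OF i] by blast
  moreover have "res i p \<in> carrier (G i)"
    using assms by (simp add: carrier_G)
  ultimately obtain k where "res i p = g i [^]\<^bsub>G i\<^esub> (k :: nat)"
    by blast
  then show ?thesis
    by (auto simp: g_power[OF i] res_eq_iff[OF i] \<theta>_def)
qed

text \<open>By counting: the \<open>\<mu> i\<close> exponents reach every nonzero value, and there
  are exactly \<open>\<mu> i\<close> such values.\<close>

lemma inj_on_\<theta>_power:
  assumes i: "i \<in> {1..m}"
  shows "inj_on (\<lambda>k. \<theta> i ^ k) {..<\<mu> i}"
proof -
  have "(\<lambda>k. \<theta> i ^ k) ` {..<\<mu> i} = range (ev i) - {0}"
  proof (intro equalityI subsetI)
    fix x assume "x \<in> range (ev i) - {0}"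
    then obtain k where "x = \<theta> i ^ k"
      using ev_eq_\<theta>_power[OF i] by auto
    then show "x \<in> (\<lambda>k. \<theta> i ^ k) ` {..<\<mu> i}"
      using \<theta>_power_mod[OF i] \<mu>_pos[of i]
      by (intro image_eqI[of _ _ "k mod \<mu> i"]) auto
  next
    fix x assume "x \<in> (\<lambda>k. \<theta> i ^ k) ` {..<\<mu> i}"
    then obtain k where "x = ev i (\<gamma> i ^ k)" by (auto simp: \<theta>_def)
    then show "x \<in> range (ev i) - {0}"
      using ev_\<gamma>_nonzero[OF i] by (metis DiffI rangeI ev_power power_eq_0_iff singletonD)
  qed
  moreover have "card (range (ev i) - {0}) = \<mu> i"
    using rangeI[of "ev i" 0] by (simp add: card_Diff_singleton card_range_ev q_power_\<l>_eq)
  ultimately show ?thesis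
    by (intro eq_card_imp_inj_on) simp_all
qed

lemma \<theta>_power_inject:
  "i \<in> {1..m} \<Longrightarrow> j < \<mu> i \<Longrightarrow> k < \<mu> i \<Longrightarrow> \<theta> i ^ j = \<theta> i ^ k \<Longrightarrow> j = k"
  using inj_on_\<theta>_power by (auto dest: inj_onD)

lemma \<omega>_eq_\<theta>_power: "i \<in> {1..m} \<Longrightarrow> \<omega> powi s i = \<theta> i ^ D i"
  using generator(3)[of i] res_eq_iff[of i "monom 1 1" "\<gamma> i ^ D i"]
  by (simp add: g_power XQ_def ev_monom \<theta>_def flip: res_def)

definition dl :: "nat \<Rightarrow> 'a poly \<Rightarrow> nat" where
  "dl i p = dlog i (to_Q p)"

lemma
  assumes i: "i \<in> {1..m}" and nz: "ev i p \<noteq> 0"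
  shows \<theta>_power_dl: "\<theta> i ^ dl i p = ev i p" and dl_less: "dl i p < \<mu> i"
proof -
  have dl: "dl i p = (LEAST k. ev i p = \<theta> i ^ k)"
    unfolding dl_def dlog_def by (simp add: g_power[OF i] res_eq_iff[OF i] \<theta>_def flip: res_def)
  obtain k where k: "ev i p = \<theta> i ^ k"
    using ev_eq_\<theta>_power[OF i nz] by blast
  then show "\<theta> i ^ dl i p = ev i p"
    unfolding dl by (metis (mono_tags, lifting) LeastI)
  have "dl i p \<le> k mod \<mu> i"
    unfolding dl using k by (intro Least_le) (simp add: \<theta>_power_mod[OF i])
  also have "\<dots> < \<mu> i"
    using \<mu>_pos[of i] by simp
  finally show "dl i p < \<mu> i" .
qed

lemma dl_eqI:
  "i \<in> {1..m} \<Longrightarrow> ev i p = \<theta> i ^ k \<Longrightarrow> dl i p = k mod \<mu> i"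
  using \<theta>_power_dl[of i p] dl_less[of i p] \<theta>_nonzero[of i] \<mu>_pos[of i]
  by (intro \<theta>_power_inject[of i]) (auto simp: \<theta>_power_mod)

text \<open>Chinese remaindering: the product of the \<open>P k\<close> with \<open>k \<noteq> j\<close> is a power of the generator
  modulo \<open>P j\<close>, so a suitable power of \<open>\<gamma> j\<close> turns it into any prescribed nonzero residue.\<close>

lemma exists_ev:
  assumes "I \<subseteq> {1..m}"
  shows "\<exists>p. \<forall>i\<in>{1..m}. ev i p = (if i \<in> I then \<theta> i ^ e i else 0)"
proof -
  define M where "M j = (\<Prod>k\<in>{1..m} - {j}. P k)" for j
  have "\<exists>r. ev j (M j * r) = \<theta> j ^ e j" if j: "j \<in> {1..m}" for j
  proof -
    have "ev j (M j) \<noteq> 0"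
      using ev_P_other[OF j] by (simp add: M_def ev_prod)
    then obtain k where k: "ev j (M j) = \<theta> j ^ k"
      using ev_eq_\<theta>_power[OF j] by blast
    \<comment> \<open>The summand \<open>(\<mu> j - 1) * k\<close> stands for the exponent -k, as
      \<open>\<theta> j ^ \<mu> j = 1\<close>.\<close>
    have "ev j (M j * \<gamma> j ^ (e j + (\<mu> j - 1) * k)) = \<theta> j ^ e j * (\<theta> j ^ (1 + (\<mu> j - 1))) ^ k"
      by (simp add: k power_add power_mult power_mult_distrib flip: \<theta>_def)
    also have "1 + (\<mu> j - 1) = \<mu> j"
      using \<mu>_pos[of j] by simp
    finally show ?thesis
      using \<theta>_power_eq_1[OF j] by (metis mult.right_neutral power_one)
  qed
  then obtain r where r: "\<And>j. j \<in> {1..m} \<Longrightarrow> ev j (M j * r j) = \<theta> j ^ e j"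
    by metis
  have "ev i (\<Sum>j\<in>I. M j * r j) = (if i \<in> I then \<theta> i ^ e i else 0)" if i: "i \<in> {1..m}" for i
  proof -
    have "ev i (M j * r j) = 0" if "j \<noteq> i" for j
      using i that by (auto simp: M_def ev_prod ev_P intro!: bexI[of _ i])
    then have "ev i (\<Sum>j\<in>I. M j * r j) = (\<Sum>j\<in>I. if j = i then ev i (M i * r i) else 0)"
      unfolding ev_sum by (intro sum.cong) auto
    also have "\<dots> = (if i \<in> I then \<theta> i ^ e i else 0)"
      using finite_subset[OF assms] r[OF i] by simp
    finally show ?thesis .
  qed
  then show ?thesis by blast
qed

section \<open>The encoding by digits\<close>

text \<open>The multiplicative order of \<omega> ^ \<open>s i\<close>, that is, of X modulo
  \<open>P i\<close>.\<close>

definition r :: "nat \<Rightarrow> nat" where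
  "r i = n div d i"

lemma int_d: "int (d i) = gcd (int n) (s i)"
  by (simp add: d_def)

lemma d_pos: "0 < d i"
  using n_pos int_d[of i] by (metis gcd_pos_int of_nat_0_less_iff less_numeral_extra(3))

lemma d_mult_r: "d i * r i = n"
proof -
  have "int (d i) dvd int n" by (simp add: int_d)
  then show ?thesis by (simp add: r_def)
qed

lemma r_pos: "0 < r i"
  using d_mult_r[of i] n_pos by (metis mult_0_right not_gr_zero)

lemma dvd_s_mult_r: "int n dvd s i * int (r i)"
proof -
  have "int (d i) dvd s i" by (simp add: int_d)
  then have "int (d i) * int (r i) dvd s i * int (r i)" by (rule mult_dvd_mono) simp
  then show ?thesis by (simp flip: of_nat_mult add: d_mult_r)
qed

lemma int_\<mu>: "int (\<mu> i) = int q ^ \<l> i - 1"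
  using q_power_\<l>_eq[of i] by (metis add_diff_cancel_left' of_nat_Suc of_nat_power)

lemma dvd_s_mult_\<mu>: "int n dvd s i * int (\<mu> i)"
  using \<l>_cong[of i] by (simp add: cong_iff_dvd_diff int_\<mu> algebra_simps)

text \<open>Cancelling \<open>d i\<close> from n | \<open>s i * \<mu> i\<close> leaves the cofactor
  \<open>s i div d i\<close>, which is coprime to \<open>r i\<close>.\<close>

lemma r_dvd_\<mu>: "r i dvd \<mu> i"
proof -
  have "int (d i) dvd s i" by (simp add: int_d)
  then obtain t where t: "s i = int (d i) * t" by (rule dvdE)
  have n: "int (d i) * int (r i) = int n"
    using d_mult_r[of i] by (metis of_nat_mult)
  have "int (d i) * int (r i) dvd int (d i) * (t * int (\<mu> i))"
    using dvd_s_mult_\<mu>[of i] unfolding t mult.assoc n .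
  then have dvd: "int (r i) dvd t * int (\<mu> i)"
    using d_pos[of i] by simp
  have "int (r i) = int n div gcd (int n) (s i)"
    unfolding r_def int_d[symmetric] by (rule zdiv_int)
  moreover have "t = s i div gcd (int n) (s i)"
    unfolding int_d[symmetric] using d_pos[of i] t by simp
  ultimately have "coprime (int (r i)) t"
    using div_gcd_coprime[of "int n" "s i"] n_pos by simp
  then show ?thesis
    using dvd by (simp add: coprime_dvd_mult_right_iff)
qed

text \<open>The division in the definition of \<open>D\<close> is exact. Hence the pairs (a, b),
  read as a * D + b, and the pairs (b, residue), read as b * r + residue, both run through all
  numbers below \<open>\<mu> i\<close>.\<close>

lemma D_mult_r: "D i * r i = \<mu> i"
proof -
  obtain c where c: "\<mu> i = r i * c" using r_dvd_\<mu> by (rule dvdE)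
  have "D i = (d i * r i * c) div n"
    unfolding D_def \<mu>_def[symmetric] c by (simp only: mult_ac)
  also have "\<dots> = c" using n_pos by (simp add: d_mult_r)
  finally show ?thesis by (simp add: c)
qed

lemma D_pos: "0 < D i"
  using D_mult_r[of i] \<mu>_pos[of i] by (metis mult_0 not_gr_zero)

section \<open>Functions on \<open>Zn\<close> as families of numbers, one for each class\<close>

definition val :: "nat \<Rightarrow> (int \<Rightarrow> nat) \<Rightarrow> nat" where
  "val i f = (\<Sum>j<\<l> i. f (elt i j) * q ^ j)"

lemma \<E>_less: "f \<in> \<E> \<Longrightarrow> f (elt i j) < q"
  using elt_in_Zn[of i j] by (auto simp: \<E>_def)

lemma val_less: "f \<in> \<E> \<Longrightarrow> val i f < q ^ \<l> i"
  unfolding val_def by (rule digit_sum_less) (rule \<E>_less)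

lemma \<E>_eqI:
  assumes "f \<in> \<E>" "f' \<in> \<E>" "\<And>i. i \<in> {1..m} \<Longrightarrow> val i f = val i f'"
  shows "f = f'"
proof (rule ext)
  fix z
  show "f z = f' z"
  proof (cases "z \<in> Zn")
    case True
    then obtain i j where ij: "i \<in> {1..m}" "j < \<l> i" "z = elt i j"
      using S_cover[OF True] by (auto simp: S_def)
    show ?thesis
      using assms(3)[OF ij(1)] \<E>_less assms(1,2) ij(2) unfolding ij(3) val_def
      by (intro digit_sum_inject[of "\<l> i" "\<lambda>j. f (elt i j)" q "\<lambda>j. f' (elt i j)"]) auto
  qed (use assms in \<open>auto simp: \<E>_def PiE_def extensional_def\<close>)
qed

lemma exists_val:
  assumes "\<And>i. i \<in> {1..m} \<Longrightarrow> v i < q ^ \<l> i"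
  shows "\<exists>f\<in>\<E>. \<forall>i\<in>{1..m}. val i f = v i"
proof -
  have "\<forall>z\<in>Zn. \<exists>i j. i \<in> {1..m} \<and> j < \<l> i \<and> z = elt i j"
    using S_cover by (fastforce simp: S_def)
  \<comment> \<open>\<open>\<iota> z\<close> is the class of \<open>z\<close> and
    \<open>\<pi> z\<close> its position there; disjointness of the classes and injectivity of
    \<open>elt\<close> make both unique.\<close>
  then obtain \<iota> \<pi> where \<iota>\<pi>: "\<And>z. z \<in> Zn \<Longrightarrow> \<iota> z \<in> {1..m} \<and> \<pi> z < \<l> (\<iota> z) \<and> z = elt (\<iota> z) (\<pi> z)"
    by metis
  define f where "f = (\<lambda>z\<in>Zn. v (\<iota> z) div q ^ \<pi> z mod q)"
  have "f \<in> \<E>"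
    using q_ge_2 by (auto simp: f_def \<E>_def)
  moreover have "val i f = v i" if i: "i \<in> {1..m}" for i
  proof -
    have "f (elt i j) = v i div q ^ j mod q" if j: "j < \<l> i" for j
    proof -
      note * = \<iota>\<pi>[OF elt_in_Zn[of i j]]
      have "\<iota> (elt i j) = i"
        using S_disjoint[of "\<iota> (elt i j)" i "elt i j"] * i elt_in_S[of i j]
          elt_in_S[of "\<iota> (elt i j)" "\<pi> (elt i j)"] by simp
      moreover from this have "\<pi> (elt i j) = j"
        using * j inj_onD[OF inj_on_elt, of i "\<pi> (elt i j)" j] by simp
      ultimately show ?thesis by (simp add: f_def)
    qed
    then have "val i f = (\<Sum>j<\<l> i. (v i div q ^ j mod q) * q ^ j)"
      by (simp add: val_def)
    also have "\<dots> = v i"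
      using assms[OF i] by (simp only: digit_sum_div_mod) simp
    finally show ?thesis .
  qed
  ultimately show ?thesis by blast
qed

lemma val_eq_\<mu>_iff:
  assumes "f \<in> \<E>"
  shows "val i f = \<mu> i \<longleftrightarrow> (\<forall>j\<in>{0..<\<l> i}. f (elt i j) = q - 1)"
proof
  have max: "(\<Sum>j<\<l> i. (q - 1) * q ^ j) = \<mu> i"
    using q_ge_2 by (simp only: \<mu>_def digit_sum_max)
  show "val i f = \<mu> i" if "\<forall>j\<in>{0..<\<l> i}. f (elt i j) = q - 1"
    using that max by (simp add: val_def)
  assume "val i f = \<mu> i"
  then have "(\<Sum>j<\<l> i. f (elt i j) * q ^ j) = (\<Sum>j<\<l> i. (q - 1) * q ^ j)"
    by (simp only: val_def max)
  then have eq: "f (elt i j) = q - 1" if "j < \<l> i" for j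
    using \<E>_less[OF assms] q_ge_2 that
    by (intro digit_sum_inject[of "\<l> i" "\<lambda>j. f (elt i j)" q "\<lambda>j. q - 1" j]) auto
  show "\<forall>j\<in>{0..<\<l> i}. f (elt i j) = q - 1"
    by (simp add: eq)
qed

text \<open>Position j of class i carries both the weight \<open>q ^ j * s i\<close> and the place
  value \<open>q ^ j\<close>, so each class contributes \<open>s i\<close> times its number.\<close>

lemma weighted_sum_cong:
  "[(\<Sum>z\<in>Zn. z * int (f z)) = (\<Sum>i\<in>{1..m}. s i * int (val i f))] (mod int n)"
proof -
  have Zn: "Zn = (\<Union>i\<in>{1..m}. S i)"
    using S_cover S_subset_Zn by blast
  have "(\<Sum>z\<in>Zn. z * int (f z)) = (\<Sum>i\<in>{1..m}. \<Sum>z\<in>S i. z * int (f z))"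
    unfolding Zn using S_disjoint finite_S by (intro sum.UNION_disjoint) auto
  also have "\<dots> = (\<Sum>i\<in>{1..m}. \<Sum>j<\<l> i. elt i j * int (f (elt i j)))"
    using inj_on_elt by (simp add: S_def atLeast0LessThan sum.reindex)
  finally have 1: "(\<Sum>z\<in>Zn. z * int (f z)) = (\<Sum>i\<in>{1..m}. \<Sum>j<\<l> i. elt i j * int (f (elt i j)))" .
  have "[elt i j = int q ^ j * s i] (mod int n)" for i j
    by (simp add: elt_def)
  then have 2: "[(\<Sum>i\<in>{1..m}. \<Sum>j<\<l> i. elt i j * int (f (elt i j)))
      = (\<Sum>i\<in>{1..m}. \<Sum>j<\<l> i. (int q ^ j * s i) * int (f (elt i j)))] (mod int n)"
    by (intro cong_sum cong_scalar_right)
  have 3: "(\<Sum>j<\<l> i. (int q ^ j * s i) * int (f (elt i j))) = s i * int (val i f)" for i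
    unfolding val_def of_nat_sum of_nat_mult of_nat_power sum_distrib_left
    by (intro sum.cong refl) (simp only: mult_ac)
  show ?thesis
    using 2 unfolding 1 3 .
qed

section \<open>The automorphisms and the numbers to be encoded\<close>

definition avec :: "nat set \<Rightarrow> 'a poly set \<Rightarrow> nat \<Rightarrow> int" where
  "avec I \<alpha> = (\<lambda>k\<in>I. int (a k \<alpha>) mod int (r k))"

definition ones :: "nat set \<Rightarrow> nat \<Rightarrow> int" where
  "ones I = (\<lambda>k\<in>I. 1 mod int (r k))"

lemma carrier_A: "carrier (A I) = (\<Pi>\<^sub>E i\<in>I. {0..<int (r i)})"
  using r_pos by (auto simp: A_def carrier_integer_mod_group PiE_def Pi_def simp flip: r_def)

lemma mult_A: "x \<otimes>\<^bsub>A I\<^esub> y = (\<lambda>i\<in>I. (x i + y i) mod int (r i))"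
  by (simp add: A_def flip: r_def)

lemma avec_in_A: "avec I \<alpha> \<in> carrier (A I)" and ones_in_A: "ones I \<in> carrier (A I)"
  using r_pos by (auto simp: avec_def ones_def carrier_A)

lemma phi_coord_eq: "phi_coord I i \<alpha> = \<phi> I (avec I \<alpha>) i"
  by (simp add: phi_coord_def avec_def r_def)

lemma h_eq: "h I i = \<phi> I (ones I) i"
  by (simp add: h_def ones_def r_def)

lemma \<phi>_bij: "I \<subseteq> {1..m} \<Longrightarrow> bij_betw (\<phi> I) (carrier (A I)) (carrier (A I))"
  and \<phi>_hom: "I \<subseteq> {1..m} \<Longrightarrow> \<phi> I \<in> hom (A I) (A I)"
  using automorphism(1) by (auto simp: iso_def)

lemma \<phi>_avec_in_A: "I \<subseteq> {1..m} \<Longrightarrow> \<phi> I (avec I \<alpha>) \<in> carrier (A I)"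
  using bij_betw_apply[OF \<phi>_bij avec_in_A] .

lemma phi_coord_bounds:
  assumes "I \<subseteq> {1..m}" "i \<in> I"
  shows "0 \<le> phi_coord I i \<alpha>" "phi_coord I i \<alpha> < int (r i)"
  using \<phi>_avec_in_A[OF assms(1), of \<alpha>] assms(2) by (auto simp: carrier_A phi_coord_eq PiE_iff)

text \<open>Turns both branches of \<open>encodes\<close> into one condition on \<open>val\<close>;
  \<open>\<mu> i\<close> is the value of the all-(q - 1) word.\<close>

definition code :: "nat set \<Rightarrow> 'a poly set \<Rightarrow> nat \<Rightarrow> nat" where
  "code I \<alpha> i = (if i \<in> I then b i \<alpha> * r i + nat (phi_coord I i \<alpha>) else \<mu> i)"

lemma encodes_iff:
  assumes "I \<subseteq> {1..m}"
  shows "encodes I \<alpha> f \<longleftrightarrow> f \<in> \<E> \<and> (\<forall>i\<in>{1..m}. val i f = code I \<alpha> i)"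
proof -
  have "(\<Sum>j = 0..<\<l> i. int (f (elt i j)) * int q ^ j) = int (b i \<alpha>) * int (n div d i) + phi_coord I i \<alpha>
      \<longleftrightarrow> val i f = code I \<alpha> i" if "i \<in> I" for i
  proof -
    have "(\<Sum>j = 0..<\<l> i. int (f (elt i j)) * int q ^ j) = int (val i f)"
      by (simp add: val_def atLeast0LessThan)
    moreover have "int (b i \<alpha>) * int (n div d i) + phi_coord I i \<alpha> = int (code I \<alpha> i)"
      using phi_coord_bounds[OF assms that, of \<alpha>] that by (simp add: code_def r_def)
    ultimately show ?thesis by (simp only: of_nat_eq_iff)
  qed
  then show ?thesis
    unfolding encodes_def using val_eq_\<mu>_iff by (auto simp: code_def split: if_splits)
qed

text \<open>From \<open>b i \<alpha> \<le> D i - 1\<close> and a residue below \<open>r i\<close>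
  the code stays below \<open>D i * r i\<close>. Strictness is what lets I be recovered from the
  code.\<close>

lemma code_less_\<mu>:
  assumes "I \<subseteq> {1..m}" "i \<in> I"
  shows "code I \<alpha> i < \<mu> i"
proof -
  have "b i \<alpha> < D i"
    using D_pos by (simp add: b_def)
  then have "Suc (b i \<alpha>) * r i \<le> D i * r i"
    by (intro mult_le_mono1) simp
  moreover have "nat (phi_coord I i \<alpha>) < r i"
    using phi_coord_bounds[OF assms, of \<alpha>] by linarith
  ultimately show ?thesis
    using assms(2) by (simp add: code_def D_mult_r)
qed

lemma encodes_ex1:
  assumes "I \<subseteq> {1..m}"
  shows "\<exists>!f. encodes I \<alpha> f"
proof (rule ex_ex1I)
  have "code I \<alpha> i < q ^ \<l> i" for i
    using code_less_\<mu>[OF assms, of i \<alpha>] by (cases "i \<in> I") (auto simp: q_power_\<l>_eq code_def)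
  then show "\<exists>f. encodes I \<alpha> f"
    unfolding encodes_iff[OF assms] using exists_val[of "code I \<alpha>"] by blast
  show "f = f'" if "encodes I \<alpha> f" "encodes I \<alpha> f'" for f f'
    using that by (auto simp: encodes_iff[OF assms] intro: \<E>_eqI)
qed

lemma varphi_eq_iff: "I \<subseteq> {1..m} \<Longrightarrow> varphi I \<alpha> = f \<longleftrightarrow> encodes I \<alpha> f"
  unfolding varphi_def by (metis encodes_ex1 the_equality)

lemma varphi_in_\<E>: "I \<subseteq> {1..m} \<Longrightarrow> varphi I \<alpha> \<in> \<E>"
  and val_varphi: "I \<subseteq> {1..m} \<Longrightarrow> i \<in> {1..m} \<Longrightarrow> val i (varphi I \<alpha>) = code I \<alpha> i"
  using varphi_eq_iff[of I \<alpha> "varphi I \<alpha>"] by (auto simp: encodes_iff)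

lemma \<Q>\<^sub>I_iff: "to_Q p \<in> \<Q>\<^sub>I I \<longleftrightarrow> (\<forall>i\<in>{1..m}. ev i p = 0 \<longleftrightarrow> i \<notin> I)"
  by (auto simp: \<Q>\<^sub>I_def to_Q_simps(1) PQ_divides_iff)

section \<open>Orbits under multiplication by \<open>X\<close>\<close>

lemma ev_shift_eq_0_iff: "ev i (monom 1 k * p) = 0 \<longleftrightarrow> ev i p = 0"
  using \<omega>_nonzero by (simp add: ev_monom)

text \<open>The logarithm is below \<open>D i * r i\<close>, so the reduction of \<open>a i\<close>
  modulo \<open>r i\<close> in \<open>avec\<close> loses nothing.\<close>

lemma a_less: "i \<in> {1..m} \<Longrightarrow> ev i p \<noteq> 0 \<Longrightarrow> a i (to_Q p) < r i"
  using dl_less[of i p] by (simp add: a_def dl_def less_mult_imp_div_less mult.commute flip: D_mult_r)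

text \<open>Multiplication by \<open>X\<close> adds \<open>D i\<close> to the discrete logarithm.\<close>

lemma a_shift:
  assumes i: "i \<in> {1..m}" and nz: "ev i p \<noteq> 0"
  shows "a i (to_Q (monom 1 k * p)) = (a i (to_Q p) + k) mod r i"
proof -
  have "ev i (monom 1 k * p) = \<theta> i ^ (dl i p + D i * k)"
    using \<theta>_power_dl[OF i nz]
    by (simp add: ev_monom \<omega>_eq_\<theta>_power[OF i] power_add power_mult flip: \<omega>_powi_power)
  then have dl: "dl i (monom 1 k * p) = (dl i p + D i * k) mod (D i * r i)"
    unfolding D_mult_r by (rule dl_eqI[OF i])
  have "(dl i p + D i * k) div D i = dl i p div D i + k"
    using D_pos[of i] by simp
  \<comment> \<open>Reducing modulo \<open>D i * r i\<close> keeps the remainder by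
    \<open>D i\<close> and reduces only the quotient, modulo \<open>r i\<close>.\<close>
  then have dl': "dl i (monom 1 k * p) = D i * ((dl i p div D i + k) mod r i) + dl i p mod D i"
    unfolding dl mod_mult2_eq by simp
  have less: "dl i p mod D i < D i"
    using D_pos[of i] by simp
  show "a i (to_Q (monom 1 k * p)) = (a i (to_Q p) + k) mod r i"
    using less D_pos[of i] dl' unfolding a_def dl_def by simp
qed

lemma avec_shift:
  assumes "I \<subseteq> {1..m}" "to_Q p \<in> \<Q>\<^sub>I I"
  shows "avec I (to_Q (monom 1 1 * p)) = avec I (to_Q p) \<otimes>\<^bsub>A I\<^esub> ones I"
proof
  fix i
  show "avec I (to_Q (monom 1 1 * p)) i = (avec I (to_Q p) \<otimes>\<^bsub>A I\<^esub> ones I) i"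
  proof (cases "i \<in> I")
    case True
    then have "a i (to_Q (monom 1 1 * p)) = (a i (to_Q p) + 1) mod r i"
      using assms by (intro a_shift) (auto simp: \<Q>\<^sub>I_iff)
    then show ?thesis
      using True by (simp add: avec_def ones_def mult_A zmod_int mod_simps add.commute)
  qed (simp add: avec_def mult_A)
qed

lemma \<Q>\<^sub>I_shift_iff: "to_Q (monom 1 k * p) \<in> \<Q>\<^sub>I I \<longleftrightarrow> to_Q p \<in> \<Q>\<^sub>I I"
  unfolding \<Q>\<^sub>I_iff ev_shift_eq_0_iff ..

text \<open>Each factor X adds \<open>ones I\<close> in \<open>A I\<close>, and
  \<open>\<phi> I\<close> is a homomorphism. A congruence modulo \<open>r i\<close> is enough, since
  after multiplication by \<open>s i\<close> it holds modulo n.\<close>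

lemma phi_coord_shift:
  assumes I: "I \<subseteq> {1..m}" and p: "to_Q p \<in> \<Q>\<^sub>I I" and i: "i \<in> I"
  shows "[phi_coord I i (to_Q (monom 1 k * p)) = phi_coord I i (to_Q p) + int k * h I i] (mod int (r i))"
proof (induction k)
  case 0
  show ?case by simp
next
  case (Suc k)
  have X: "monom 1 (Suc k) * p = monom 1 1 * (monom 1 k * p)"
    by (simp add: mult_monom mult.assoc[symmetric])
  have "\<phi> I (avec I (to_Q (monom 1 (Suc k) * p)))
      = \<phi> I (avec I (to_Q (monom 1 k * p))) \<otimes>\<^bsub>A I\<^esub> \<phi> I (ones I)"
    unfolding X using p I
    by (subst avec_shift) (simp_all add: \<Q>\<^sub>I_shift_iff hom_mult[OF \<phi>_hom] avec_in_A ones_in_A)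
  then have "phi_coord I i (to_Q (monom 1 (Suc k) * p))
      = (phi_coord I i (to_Q (monom 1 k * p)) + h I i) mod int (r i)"
    using i by (simp add: phi_coord_eq h_eq mult_A)
  then have "[phi_coord I i (to_Q (monom 1 (Suc k) * p))
      = phi_coord I i (to_Q (monom 1 k * p)) + h I i] (mod int (r i))"
    by simp
  also have "[phi_coord I i (to_Q (monom 1 k * p)) + h I i
      = phi_coord I i (to_Q p) + int k * h I i + h I i] (mod int (r i))"
    using Suc by (intro cong_add) simp_all
  finally show ?case by (simp add: algebra_simps)
qed

section \<open>The weight along an orbit\<close>

definition wt :: "nat set \<Rightarrow> 'a poly set \<Rightarrow> int" where
  "wt I \<alpha> = (\<Sum>i\<in>I. s i * phi_coord I i \<alpha>)"

text \<open>For i in I, n | \<open>s i * r i\<close> removes the part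
  \<open>b i \<alpha> * r i\<close> of the code; for i outside I, n | \<open>s i * \<mu> i\<close>
  removes all of it.\<close>

lemma varphi_in_\<F>_iff:
  assumes "I \<subseteq> {1..m}"
  shows "varphi I \<alpha> \<in> \<F> \<longleftrightarrow> int n dvd wt I \<alpha>"
proof -
  have cong: "[s i * int (code I \<alpha> i) = (if i \<in> I then s i * phi_coord I i \<alpha> else 0)] (mod int n)" for i
  proof (cases "i \<in> I")
    case True
    then have "s i * int (code I \<alpha> i) - s i * phi_coord I i \<alpha> = s i * int (r i) * int (b i \<alpha>)"
      using phi_coord_bounds(1)[OF assms True, of \<alpha>] by (simp add: code_def algebra_simps)
    then show ?thesis
      using True dvd_s_mult_r[of i] by (simp add: cong_iff_dvd_diff)
  next
    case False
    then show ?thesis using dvd_s_mult_\<mu>[of i] by (simp add: code_def cong_0_iff)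
  qed
  have "(\<Sum>i\<in>{1..m}. if i \<in> I then s i * phi_coord I i \<alpha> else 0) = wt I \<alpha>"
    unfolding wt_def using assms by (intro sum.mono_neutral_cong_right) auto
  moreover have "(\<Sum>i\<in>{1..m}. s i * int (val i (varphi I \<alpha>))) = (\<Sum>i\<in>{1..m}. s i * int (code I \<alpha> i))"
    by (intro sum.cong refl) (simp add: val_varphi[OF assms])
  moreover have "[(\<Sum>i\<in>{1..m}. s i * int (code I \<alpha> i))
      = (\<Sum>i\<in>{1..m}. if i \<in> I then s i * phi_coord I i \<alpha> else 0)] (mod int n)"
    by (intro cong_sum cong)
  ultimately have "[(\<Sum>z\<in>Zn. z * int (varphi I \<alpha> z)) = wt I \<alpha>] (mod int n)"
    using weighted_sum_cong[of "varphi I \<alpha>"] by (metis cong_trans)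
  then show ?thesis
    using varphi_in_\<E>[OF assms, of \<alpha>] by (auto simp: \<F>_def cong_0_iff cong_dvd_iff)
qed

definition e :: "nat set \<Rightarrow> int" where
  "e I = gcd (int n) (Gcd (s ` I))"

lemma e_dvd_s: "i \<in> I \<Longrightarrow> e I dvd s i"
  by (auto simp: e_def intro: dvd_trans[OF gcd_dvd2 Gcd_dvd])

lemma wt_shift:
  assumes I: "I \<subseteq> {1..m}" and p: "to_Q p \<in> \<Q>\<^sub>I I"
  shows "[wt I (to_Q (monom 1 k * p)) = wt I (to_Q p) + int k * e I] (mod int n)"
proof -
  have "[s i * phi_coord I i (to_Q (monom 1 k * p))
      = s i * (phi_coord I i (to_Q p) + int k * h I i)] (mod int n)" if "i \<in> I" for i
    using phi_coord_shift[OF I p that, of k] dvd_s_mult_r[of i]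
    unfolding cong_iff_dvd_diff right_diff_distrib[symmetric]
    by (metis dvd_trans mult_dvd_mono dvd_refl)
  then have 1: "[wt I (to_Q (monom 1 k * p))
      = (\<Sum>i\<in>I. s i * (phi_coord I i (to_Q p) + int k * h I i))] (mod int n)"
    unfolding wt_def by (rule cong_sum)
  have 2: "(\<Sum>i\<in>I. s i * (phi_coord I i (to_Q p) + int k * h I i))
      = wt I (to_Q p) + int k * (\<Sum>i\<in>I. s i * h I i)"
    by (simp add: wt_def sum.distrib sum_distrib_left algebra_simps)
  have 3: "[wt I (to_Q p) + int k * (\<Sum>i\<in>I. s i * h I i) = wt I (to_Q p) + int k * e I] (mod int n)"
    using automorphism(2)[OF I] unfolding e_def by (intro cong_add cong_mult cong_refl)
  show ?thesis
    using 1 3 unfolding 2 by (rule cong_trans)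
qed

text \<open>Outside I both sides evaluate to 0; inside I the nonzero value of \<open>p\<close>
  cancels.\<close>

lemma shift_eq_iff:
  assumes I: "I \<subseteq> {1..m}" and p: "to_Q p \<in> \<Q>\<^sub>I I"
  shows "to_Q (monom 1 j * p) = to_Q (monom 1 k * p) \<longleftrightarrow> (\<forall>i\<in>I. [int j * s i = int k * s i] (mod int n))"
  using I p by (auto simp: to_Q_eq_iff ev_monom \<omega>_powi_eq_iff \<Q>\<^sub>I_iff)

text \<open>Exponents freed from the bound n can be added without reduction.\<close>

lemma orbit_eq: "orbit (to_Q p) = range (\<lambda>k. to_Q (monom 1 k * p))"
proof -
  have image: "orbit (to_Q p) = (\<lambda>k. to_Q (monom 1 k * p)) ` {0..<n}"
    by (auto simp: orbit_def XQ_def to_Q_power to_Q_simps(2) monom_power)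
  have mod: "to_Q (monom 1 k * p) = to_Q (monom 1 (k mod n) * p)" for k
  proof -
    have "[int k * s i = int (k mod n) * s i] (mod int n)" for i
      by (intro cong_mult cong_refl) (simp add: zmod_int)
    then have "ev i (monom 1 k) = ev i (monom 1 (k mod n))" for i
      unfolding ev_monom \<omega>_powi_eq_iff .
    then show ?thesis unfolding to_Q_eq_iff ev_simps by simp
  qed
  have "range (\<lambda>k. to_Q (monom 1 k * p)) \<subseteq> (\<lambda>k. to_Q (monom 1 k * p)) ` {0..<n}"
  proof (rule image_subsetI)
    fix k
    show "to_Q (monom 1 k * p) \<in> (\<lambda>k. to_Q (monom 1 k * p)) ` {0..<n}"
      unfolding mod[of k] using n_pos by (intro imageI) simp
  qed
  then show ?thesis unfolding image by blast
qed

lemma orbit_shift: "orbit (to_Q (monom 1 k * p)) = orbit (to_Q p)"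
proof -
  have shift: "monom 1 j * (monom 1 k * p) = monom 1 (j + k) * p" for j
    by (simp add: mult_monom mult.assoc[symmetric])
  have "to_Q (monom 1 j * p) \<in> range (\<lambda>j. to_Q (monom 1 (j + k) * p))" for j
  proof (rule range_eqI)
    \<comment> \<open>X ^ ((n - 1) * k) undoes X ^ k, because X ^ n acts as the identity.\<close>
    have *: "j + (n - 1) * k + k = j + n * k"
      using n_pos by (cases n) simp_all
    show "to_Q (monom 1 j * p) = to_Q (monom 1 (j + (n - 1) * k + k) * p)"
      unfolding * by (simp add: to_Q_eq_iff ev_monom \<omega>_powi_eq_iff cong_iff_dvd_diff algebra_simps)
  qed
  then show ?thesis unfolding orbit_eq shift by blast
qed

lemma orbit_subset_\<Q>\<^sub>I: "to_Q p \<in> \<Q>\<^sub>I I \<Longrightarrow> orbit (to_Q p) \<subseteq> \<Q>\<^sub>I I"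
  by (auto simp: orbit_eq \<Q>\<^sub>I_shift_iff)

lemma self_in_orbit: "to_Q p \<in> orbit (to_Q p)"
  unfolding orbit_eq by (rule range_eqI[of _ _ 0]) simp

text \<open>I collects the i with \<open>ev i p \<noteq> 0\<close>, a condition that shifts
  preserve. It is unique because the orbit is nonempty and I lies within \<open>{1..m}\<close>, the
  only indices that \<open>\<Q>\<^sub>I\<close> inspects.\<close>

lemma index_ex1:
  assumes "N \<in> \<N>"
  shows "\<exists>!I. I \<subseteq> {1..m} \<and> N \<subseteq> \<Q>\<^sub>I I"
proof -
  obtain p where N: "N = orbit (to_Q p)"
    using assms by (auto simp: \<N>_def carrier_Q)
  show ?thesis
  proof (rule ex1I[of _ "{i\<in>{1..m}. ev i p \<noteq> 0}"])
    show "{i\<in>{1..m}. ev i p \<noteq> 0} \<subseteq> {1..m} \<and> N \<subseteq> \<Q>\<^sub>I {i\<in>{1..m}. ev i p \<noteq> 0}"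
      unfolding N by (intro conjI orbit_subset_\<Q>\<^sub>I) (auto simp: \<Q>\<^sub>I_iff)
    show "I = {i\<in>{1..m}. ev i p \<noteq> 0}" if "I \<subseteq> {1..m} \<and> N \<subseteq> \<Q>\<^sub>I I" for I
    proof -
      have "to_Q p \<in> \<Q>\<^sub>I I"
        using that self_in_orbit N by blast
      then show ?thesis using that by (auto simp: \<Q>\<^sub>I_iff)
    qed
  qed
qed

lemma index_set_eqI: "N \<in> \<N> \<Longrightarrow> I \<subseteq> {1..m} \<Longrightarrow> N \<subseteq> \<Q>\<^sub>I I \<Longrightarrow> index_set N = I"
  unfolding index_set_def by (rule the1_equality[OF index_ex1]) simp_all

lemma index_set:
  assumes "N \<in> \<N>"
  shows "index_set N \<subseteq> {1..m}" "N \<subseteq> \<Q>\<^sub>I (index_set N)"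
  using theI'[OF index_ex1[OF assms]] unfolding index_set_def by blast+

text \<open>Along an orbit the weight advances in steps of \<open>e I\<close>, which divides the weight, and the
  stabiliser of \<open>\<alpha> \<in> \<Q>\<^sub>I I\<close> consists of the \<open>k\<close> with \<open>n\<close> dividing \<open>k * e I\<close>.\<close>

lemma orbit_ex1:
  assumes I: "I \<subseteq> {1..m}" and p: "to_Q p \<in> \<Q>\<^sub>I I"
  shows "\<exists>!\<beta>. \<beta> \<in> orbit (to_Q p) \<and> varphi I \<beta> \<in> \<F>"
proof (rule ex_ex1I)
  have "e I dvd wt I (to_Q p)"
    unfolding wt_def by (intro dvd_sum dvd_mult2 e_dvd_s)
  then obtain t where t: "wt I (to_Q p) = e I * t" by (rule dvdE)
  \<comment> \<open>Chosen to make t + k divisible by n; the weight after k shifts is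
    \<open>e I * (t + k)\<close> modulo n.\<close>
  define k where "k = nat ((- t) mod int n)"
  have k: "int k = (- t) mod int n"
    using n_pos by (simp add: k_def)
  have "[t + int k = t + (- t)] (mod int n)"
    unfolding k by (intro cong_add cong_refl cong_mod_leftI)
  then have "int n dvd e I * (t + int k)"
    by (simp add: cong_0_iff)
  then have "int n dvd wt I (to_Q p) + int k * e I"
    by (simp add: t algebra_simps)
  then have "int n dvd wt I (to_Q (monom 1 k * p))"
    using wt_shift[OF I p, of k] by (simp add: cong_dvd_iff)
  then show "\<exists>\<beta>. \<beta> \<in> orbit (to_Q p) \<and> varphi I \<beta> \<in> \<F>"
    by (auto simp: orbit_eq varphi_in_\<F>_iff[OF I])
next
  fix \<beta> \<beta>'
  assume "\<beta> \<in> orbit (to_Q p) \<and> varphi I \<beta> \<in> \<F>" "\<beta>' \<in> orbit (to_Q p) \<and> varphi I \<beta>' \<in> \<F>"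
  then obtain j k where jk: "\<beta> = to_Q (monom 1 j * p)" "\<beta>' = to_Q (monom 1 k * p)"
    and dvd: "int n dvd wt I \<beta>" "int n dvd wt I \<beta>'"
    by (auto simp: orbit_eq varphi_in_\<F>_iff[OF I])
  have "int n dvd wt I (to_Q p) + int j * e I" "int n dvd wt I (to_Q p) + int k * e I"
    using dvd wt_shift[OF I p, of j] wt_shift[OF I p, of k] by (simp_all add: jk cong_dvd_iff)
  then have "int n dvd (wt I (to_Q p) + int j * e I) - (wt I (to_Q p) + int k * e I)"
    by (rule dvd_diff)
  then have "int n dvd (int j - int k) * e I"
    by (simp add: left_diff_distrib)
  then have "int n dvd (int j - int k) * s i" if "i \<in> I" for i
    using e_dvd_s[OF that] by (meson dvd_trans mult_dvd_mono dvd_refl)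
  then show "\<beta> = \<beta>'"
    unfolding jk shift_eq_iff[OF I p] by (simp add: cong_iff_dvd_diff left_diff_distrib)
qed

section \<open>Decoding, and the bijection on necklaces\<close>

text \<open>The i in I are those with code different from \<open>\<mu> i\<close>. Division by
  \<open>r i\<close> separates \<open>b i\<close> from the residue, bijectivity of
  \<open>\<phi> I\<close> returns \<open>a i\<close>, and the two rebuild the logarithm. Allowing I
  and J to differ also shows that the images for different index sets are disjoint.\<close>

lemma varphi_inject:
  assumes I: "I \<subseteq> {1..m}" "J \<subseteq> {1..m}" and p: "to_Q p \<in> \<Q>\<^sub>I I" and p': "to_Q p' \<in> \<Q>\<^sub>I J"
    and eq: "varphi I (to_Q p) = varphi J (to_Q p')"
  shows "I = J" "to_Q p = to_Q p'"
proof -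
  have code: "code I (to_Q p) i = code J (to_Q p') i" if "i \<in> {1..m}" for i
    using that eq val_varphi[OF I(1) that] val_varphi[OF I(2) that] by metis
  have in_iff: "i \<in> I \<longleftrightarrow> code I (to_Q p) i \<noteq> \<mu> i" "i \<in> J \<longleftrightarrow> code J (to_Q p') i \<noteq> \<mu> i" for i
    using code_less_\<mu>[OF I(1), of i "to_Q p"] code_less_\<mu>[OF I(2), of i "to_Q p'"]
    by (auto simp: code_def)
  show IJ: "I = J"
  proof (rule Set.set_eqI)
    fix i
    show "i \<in> I \<longleftrightarrow> i \<in> J"
    proof (cases "i \<in> {1..m}")
      case True
      then show ?thesis by (simp only: in_iff code)
    qed (use I in blast)
  qed
  have ab: "b i (to_Q p) = b i (to_Q p') \<and> phi_coord I i (to_Q p) = phi_coord I i (to_Q p')"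
    if i: "i \<in> I" for i
  proof -
    note bounds = phi_coord_bounds[OF I(1) i]
    have less: "nat (phi_coord I i \<alpha>) < r i" for \<alpha>
      using bounds[of \<alpha>] by linarith
    have eq: "b i (to_Q p) * r i + nat (phi_coord I i (to_Q p))
        = b i (to_Q p') * r i + nat (phi_coord I i (to_Q p'))"
      using code[of i] i I(1) by (auto simp: code_def IJ)
    have "b i (to_Q p) = b i (to_Q p')"
      using arg_cong[OF eq, of "\<lambda>x. x div r i"] less r_pos[of i] by simp
    moreover have "nat (phi_coord I i (to_Q p)) = nat (phi_coord I i (to_Q p'))"
      using arg_cong[OF eq, of "\<lambda>x. x mod r i"] less by simp
    ultimately show ?thesis
      using bounds(1)[of "to_Q p"] bounds(1)[of "to_Q p'"] by simp
  qed
  have "\<phi> I (avec I (to_Q p)) i = \<phi> I (avec I (to_Q p')) i" for i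
    using ab[of i] \<phi>_avec_in_A[OF I(1)]
    by (cases "i \<in> I") (auto simp: phi_coord_eq carrier_A PiE_def extensional_def)
  then have "\<phi> I (avec I (to_Q p)) = \<phi> I (avec I (to_Q p'))" ..
  then have "avec I (to_Q p) = avec I (to_Q p')"
    by (rule inj_onD[OF bij_betw_imp_inj_on[OF \<phi>_bij[OF I(1)]]]) (rule avec_in_A)+
  then have avec: "avec I (to_Q p) i = avec I (to_Q p') i" for i by simp
  have "ev i p = ev i p'" if i: "i \<in> {1..m}" for i
  proof (cases "i \<in> I")
    case True
    then have nz: "ev i p \<noteq> 0" "ev i p' \<noteq> 0"
      using p p' i by (auto simp: \<Q>\<^sub>I_iff IJ)
    have "a i (to_Q p) = a i (to_Q p')"
      using avec[of i] True a_less[OF i nz(1)] a_less[OF i nz(2)] by (simp add: avec_def)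
    then have "dl i p = dl i p'"
      using ab[OF True] div_mult_mod_eq[of "dl i p" "D i"] div_mult_mod_eq[of "dl i p'" "D i"]
      unfolding a_def b_def dl_def by metis
    then show ?thesis
      using \<theta>_power_dl[OF i nz(1)] \<theta>_power_dl[OF i nz(2)] by simp
  next
    case False
    then have "ev i p = 0" "ev i p' = 0"
      using p p' i unfolding \<Q>\<^sub>I_iff IJ by blast+
    then show ?thesis by simp
  qed
  then show "to_Q p = to_Q p'" by (simp add: to_Q_eq_iff)
qed

lemma varphi_surj:
  assumes f: "f \<in> \<E>"
  shows "\<exists>I p. I \<subseteq> {1..m} \<and> to_Q p \<in> \<Q>\<^sub>I I \<and> varphi I (to_Q p) = f"
proof -
  define I where "I = {i\<in>{1..m}. val i f \<noteq> \<mu> i}"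
  have I: "I \<subseteq> {1..m}" by (auto simp: I_def)
  define y where "y = (\<lambda>i\<in>I. int (val i f mod r i))"
  have "y \<in> carrier (A I)"
    using r_pos by (auto simp: y_def carrier_A)
  then obtain x where x: "x \<in> carrier (A I)" "\<phi> I x = y"
    using \<phi>_bij[OF I] by (metis bij_betw_imp_surj_on imageE)
  \<comment> \<open>The logarithm whose quotient by \<open>D i\<close> is the preimage coordinate
    \<open>x i\<close> and whose remainder is the upper part of the code.\<close>
  define c where "c i = nat (x i) * D i + val i f div r i" for i
  obtain p where p: "\<And>i. i \<in> {1..m} \<Longrightarrow> ev i p = (if i \<in> I then \<theta> i ^ c i else 0)"
    using exists_ev[OF I, of c] by blast
  have p_in: "to_Q p \<in> \<Q>\<^sub>I I"
    using \<theta>_nonzero by (auto simp: \<Q>\<^sub>I_iff p)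
  have ab: "a i (to_Q p) = nat (x i) \<and> b i (to_Q p) = val i f div r i" if i: "i \<in> I" for i
  proof -
    have "val i f < \<mu> i"
      using val_less[OF f, of i] i by (auto simp: I_def q_power_\<l>_eq)
    then have div_less: "val i f div r i < D i"
      by (simp add: less_mult_imp_div_less flip: D_mult_r)
    have "nat (x i) < r i"
      using x(1) i r_pos[of i] by (auto simp: carrier_A PiE_iff)
    then have "Suc (nat (x i)) * D i \<le> r i * D i"
      by (intro mult_le_mono1) simp
    then have "c i < \<mu> i"
      using div_less by (simp add: c_def D_mult_r[of i, symmetric] mult.commute)
    moreover have "dl i p = c i mod \<mu> i"
      using i I p by (intro dl_eqI) auto
    ultimately have "dl i p = c i" by simp
    then show ?thesis
      using div_less unfolding a_def b_def dl_def by (simp add: c_def)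
  qed
  have "avec I (to_Q p) = x"
  proof
    fix i
    show "avec I (to_Q p) i = x i"
      using x(1) ab[of i] by (cases "i \<in> I") (auto simp: avec_def carrier_A PiE_iff extensional_def)
  qed
  then have "phi_coord I i (to_Q p) = int (val i f mod r i)" if "i \<in> I" for i
    using that x(2) by (simp add: phi_coord_eq y_def)
  then have "val i f = code I (to_Q p) i" if "i \<in> {1..m}" for i
    using that ab[of i] by (auto simp: code_def I_def)
  then have "varphi I (to_Q p) = f"
    using f by (simp add: varphi_eq_iff[OF I] encodes_iff[OF I])
  then show ?thesis using I p_in by blast
qed

lemma necklace_ex1:
  assumes N: "N \<in> \<N>"
  shows "\<exists>!\<beta>. \<beta> \<in> N \<and> varphi (index_set N) \<beta> \<in> \<F>"
proof -
  obtain p where p: "N = orbit (to_Q p)"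
    using N by (auto simp: \<N>_def carrier_Q)
  then show ?thesis
    using index_set[OF N] self_in_orbit[of p] by (auto intro!: orbit_ex1)
qed

text \<open>The polynomial is taken to represent the selected element itself, so that
  \<open>varphi_inject\<close> applies directly to values of \<open>phihat\<close>.\<close>

lemma phihat_eq:
  assumes N: "N \<in> \<N>"
  shows "\<exists>p. N = orbit (to_Q p) \<and> to_Q p \<in> \<Q>\<^sub>I (index_set N) \<and>
    phihat N = varphi (index_set N) (to_Q p) \<and> phihat N \<in> \<F>"
proof -
  define \<beta> where "\<beta> = (THE \<beta>. \<beta> \<in> N \<and> varphi (index_set N) \<beta> \<in> \<F>)"
  have \<beta>: "\<beta> \<in> N" "varphi (index_set N) \<beta> \<in> \<F>"
    using theI'[OF necklace_ex1[OF N]] by (simp_all add: \<beta>_def)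
  obtain p where p: "N = orbit (to_Q p)"
    using N by (auto simp: \<N>_def carrier_Q)
  then obtain k where "\<beta> = to_Q (monom 1 k * p)"
    using \<beta>(1) by (auto simp: orbit_eq)
  then show ?thesis
    using \<beta> p index_set(2)[OF N] unfolding phihat_def \<beta>_def[symmetric]
    by (intro exI[of _ "monom 1 k * p"]) (auto simp: orbit_shift)
qed

lemma bij_phihat: "bij_betw phihat \<N> \<F>"
proof (rule bij_betw_imageI)
  show "inj_on phihat \<N>"
  proof (rule inj_onI)
    fix N N' assume N: "N \<in> \<N>" "N' \<in> \<N>" and eq: "phihat N = phihat N'"
    obtain p p' where p: "N = orbit (to_Q p)" "to_Q p \<in> \<Q>\<^sub>I (index_set N)"
        "phihat N = varphi (index_set N) (to_Q p)"
      and p': "N' = orbit (to_Q p')" "to_Q p' \<in> \<Q>\<^sub>I (index_set N')"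
        "phihat N' = varphi (index_set N') (to_Q p')"
      using phihat_eq[OF N(1)] phihat_eq[OF N(2)] by blast
    have "to_Q p = to_Q p'"
      using eq p p' index_set(1)[OF N(1)] index_set(1)[OF N(2)]
      by (intro varphi_inject(2)[of "index_set N" "index_set N'"]) simp_all
    then show "N = N'" by (simp add: p p')
  qed
  show "phihat ` \<N> = \<F>"
  proof (intro equalityI subsetI)
    fix f assume f: "f \<in> \<F>"
    then obtain I p where I: "I \<subseteq> {1..m}" and p: "to_Q p \<in> \<Q>\<^sub>I I" "varphi I (to_Q p) = f"
      using varphi_surj[of f] by (auto simp: \<F>_def)
    have N: "orbit (to_Q p) \<in> \<N>"
      by (simp add: \<N>_def carrier_Q)
    have index: "index_set (orbit (to_Q p)) = I"
      using N I orbit_subset_\<Q>\<^sub>I[OF p(1)] by (rule index_set_eqI)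
    \<comment> \<open>As \<open>f\<close> lies in \<open>\<F>\<close>, its preimage is the element
      that the definition of \<open>phihat\<close> selects in the orbit.\<close>
    have "(THE \<beta>. \<beta> \<in> orbit (to_Q p) \<and> varphi I \<beta> \<in> \<F>) = to_Q p"
      using orbit_ex1[OF I p(1)] self_in_orbit p(2) f by (intro the1_equality) auto
    then have "phihat (orbit (to_Q p)) = f"
      by (simp add: phihat_def index p(2))
    then show "f \<in> phihat ` \<N>" using N by blast
  qed (use phihat_eq in blast)
qed

end

text \<open>Well-definedness is rendered as unique existence for the \<open>THE\<close> descriptions
  behind \<open>phihat\<close>: the word, the index set and the selected element.\<close>

theorem theorem1p2:
  fixes q n m :: nat
    and s :: "nat \<Rightarrow> int"
    and \<omega> :: "'a :: finite_field alg_closure"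
    and g :: "nat \<Rightarrow> 'a poly set set"
    and \<phi> :: "nat set \<Rightarrow> (nat \<Rightarrow> int) \<Rightarrow> (nat \<Rightarrow> int)"
  assumes "primepow q" and "card (UNIV :: 'a set) = q"
    and "0 < n" and "coprime n q"
    and "necklace_choices q n m s \<omega> g \<phi>"
  shows "(\<forall>I \<alpha>. I \<subseteq> {1..m} \<and> \<alpha> \<in> necklace_data.\<Q>\<^sub>I q n m s \<omega> I
            \<longrightarrow> (\<exists>!f. necklace_data.encodes q n m s \<omega> g \<phi> I \<alpha> f))
       \<and> (\<forall>N \<in> (necklace_data.\<N> n :: 'a poly set set set).
            (\<exists>!I. I \<subseteq> {1..m} \<and> N \<subseteq> necklace_data.\<Q>\<^sub>I q n m s \<omega> I)
          \<and> (\<exists>!\<beta>. \<beta> \<in> N \<and>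
               necklace_data.varphi q n m s \<omega> g \<phi> (necklace_data.index_set q n m s \<omega> N) \<beta>
                 \<in> necklace_data.\<F> q n))
       \<and> bij_betw (necklace_data.phihat q n m s \<omega> g \<phi>)
            (necklace_data.\<N> n :: 'a poly set set set) (necklace_data.\<F> q n)"
proof -
  interpret necklace_setting q n m s \<omega> g \<phi>
    using assms by (simp add: necklace_setting_def necklace_setting_axioms_def)
  show ?thesis
    by (intro conjI allI impI ballI encodes_ex1 index_ex1 necklace_ex1 bij_phihat) simp_all
qed

end
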